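(* Let $n\in\mathbb N$, let $X_1,\dots,X_n$ be $\mathcal L_1$ spaces and let $Y$ be a Banach space (all over the same field $\mathbb R$ or $\mathbb C$). Then $$\Pi_1^{Lip}(X_1,\dots,X_n;Y)=\Pi_2^{Lip}(X_1,\dots,X_n;Y).$$
   Context: $\mathcal L(X_1,\dots,X_n)$ is the space of bounded scalar $n$-linear forms with the supremum norm over the product of unit balls, $B_E$ the closed unit ball of $E$. For $1\le p<\infty$, a bounded $n$-linear operator $T:X_1\times\cdots\times X_n\to Y$ is Lipschitz $p$-summing, $T\in\Pi_p^{Lip}(X_1,\dots,X_n;Y)$, if there is $c>0$ such that for all $k\in\mathbb N$ and all $u_1,\dots,u_k,v_1,\dots,v_k\in X_1\times\cdots\times X_n$, $$\Big(\sum_{i=1}^k\|T(u_i)-T(v_i)\|^p\Big)^{1/p}\le c\cdot\sup_{\varphi\in B_{\mathcal L(X_1,\dots,X_n)}}\Big(\sum_{i=1}^k|\varphi(u_i)-\varphi(v_i)|^p\Big)^{1/p}.$$ $\mathcal L_1$ spaces are in the sense of Lindenstrauss-Pełczyński: $X$ is an $\mathcal L_1$ space if for some $\lambda\ge1$ every finite dimensional subspace of $X$ is contained in a finite dimensional subspace $F\subset X$ admitting an isomorphism $v:F\to\ell_1^{\dim F}$ with $\|v\|\,\|v^{-1}\|\le\lambda$. *)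

theory Defs
  imports "HOL-Analysis.Analysis"
begin

text \<open>
  The scalar field is a type of sort \<open>{real_normed_field, euclidean_space}\<close>.  Its members are the
  finite-dimensional commutative real division algebras with a multiplicative norm that comes from
  an inner product, so by Frobenius they are, up to isometric isomorphism, exactly \<open>real\<close> and
  \<open>complex\<close>.  The last axiom below only says that the real structure of the type class is the one
  obtained by restricting scalars.
\<close>

locale normed_space_over = vector_space smul
  for smul :: "'k::{real_normed_field,euclidean_space} \<Rightarrow> 'a::real_normed_vector \<Rightarrow> 'a" +
  assumes norm_smul: "norm (smul c x) = norm c * norm x"
    and smul_of_real: "smul (of_real r) x = r *\<^sub>R x"

text \<open>
  A finite family of Banach spaces \<open>X 1, \<dots>, X n\<close> is a family of complete linear subspaces of one
  normed space.  This is no restriction: any such family embeds isometrically, coordinate by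
  coordinate, into its \<open>\<ell>\<^sub>1\<close>-direct sum.  Nothing below refers to the ambient space outside
  the \<open>X i\<close>, nor to how the \<open>X i\<close> lie relative to each other.
\<close>

definition banach_subspace ::
    "('k::{real_normed_field,euclidean_space} \<Rightarrow> 'a::real_normed_vector \<Rightarrow> 'a) \<Rightarrow> 'a set \<Rightarrow> bool" where
  "banach_subspace smul X \<longleftrightarrow> module.subspace smul X \<and> complete X"

definition fin_dim_subspace ::
    "('k::{real_normed_field,euclidean_space} \<Rightarrow> 'a::real_normed_vector \<Rightarrow> 'a) \<Rightarrow> 'a set \<Rightarrow> bool" where
  "fin_dim_subspace smul E \<longleftrightarrow> (\<exists>B. finite B \<and> E = module.span smul B)"

text \<open>The elements of \<open>\<ell>\<^sub>1\<^sup>d\<close> are functions vanishing outside \<open>{1..d}\<close>.\<close>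

definition l1_carrier :: "nat \<Rightarrow> (nat \<Rightarrow> 'k::real_normed_field) set" where
  "l1_carrier d = {z. \<forall>j. j \<notin> {1..d} \<longrightarrow> z j = 0}"

definition l1_norm :: "nat \<Rightarrow> (nat \<Rightarrow> 'k::real_normed_field) \<Rightarrow> real" where
  "l1_norm d z = (\<Sum>j=1..d. norm (z j))"

definition linear_iso_l1 ::
    "('k::{real_normed_field,euclidean_space} \<Rightarrow> 'a::real_normed_vector \<Rightarrow> 'a) \<Rightarrow> 'a set \<Rightarrow> nat
      \<Rightarrow> ('a \<Rightarrow> nat \<Rightarrow> 'k) \<Rightarrow> bool" where
  "linear_iso_l1 smul F d v \<longleftrightarrow>
     bij_betw v F (l1_carrier d) \<and>
     (\<forall>x\<in>F. \<forall>y\<in>F. v (x + y) = (\<lambda>j. v x j + v y j)) \<and>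
     (\<forall>c. \<forall>x\<in>F. v (smul c x) = (\<lambda>j. c * v x j))"

text \<open>
  The operator norm of \<open>f\<close> from \<open>S\<close>, normed by \<open>nS\<close>, to a space normed by \<open>nT\<close>.  It is only used for
  linear maps on finite-dimensional spaces, where the supremum is finite.
\<close>

definition op_norm :: "'s set \<Rightarrow> ('s \<Rightarrow> real) \<Rightarrow> ('t \<Rightarrow> real) \<Rightarrow> ('s \<Rightarrow> 't) \<Rightarrow> real" where
  "op_norm S nS nT f = (SUP x\<in>{x\<in>S. nS x \<le> 1}. nT (f x))"

definition script_L1_space ::
    "('k::{real_normed_field,euclidean_space} \<Rightarrow> 'a::real_normed_vector \<Rightarrow> 'a) \<Rightarrow> 'a set \<Rightarrow> bool" where
  "script_L1_space smul X \<longleftrightarrow>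
     banach_subspace smul X \<and>
     (\<exists>C\<ge>1. \<forall>E. fin_dim_subspace smul E \<and> E \<subseteq> X \<longrightarrow>
        (\<exists>F v. fin_dim_subspace smul F \<and> E \<subseteq> F \<and> F \<subseteq> X \<and>
           (let d = vector_space.dim smul F in
              linear_iso_l1 smul F d v \<and>
              op_norm F norm (l1_norm d) v *
                op_norm (l1_carrier d) (l1_norm d) norm (inv_into F v) \<le> C)))"

text \<open>
  The product \<open>X\<^sub>1 \<times> \<dots> \<times> X\<^sub>n\<close> is \<open>\<Pi>\<^sub>E i\<in>{1..n}. X i\<close>.  Operators on it are made extensional, so that
  equality of HOL functions is equality of operators.
\<close>

definition unit_ball_prod :: "nat \<Rightarrow> (nat \<Rightarrow> 'a::real_normed_vector set) \<Rightarrow> (nat \<Rightarrow> 'a) set" where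
  "unit_ball_prod n X = (\<Pi>\<^sub>E i\<in>{1..n}. X i \<inter> cball 0 1)"

definition bounded_multilinear ::
    "('k::{real_normed_field,euclidean_space} \<Rightarrow> 'a::real_normed_vector \<Rightarrow> 'a)
      \<Rightarrow> ('k \<Rightarrow> 'b::real_normed_vector \<Rightarrow> 'b) \<Rightarrow> nat \<Rightarrow> (nat \<Rightarrow> 'a set) \<Rightarrow> ((nat \<Rightarrow> 'a) \<Rightarrow> 'b) set" where
  "bounded_multilinear smulX smulY n X =
     {T \<in> extensional (\<Pi>\<^sub>E i\<in>{1..n}. X i).
        (\<forall>u\<in>(\<Pi>\<^sub>E i\<in>{1..n}. X i). \<forall>i\<in>{1..n}. \<forall>x\<in>X i. \<forall>y\<in>X i.
           T (u(i := x + y)) = T (u(i := x)) + T (u(i := y))) \<and>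
        (\<forall>u\<in>(\<Pi>\<^sub>E i\<in>{1..n}. X i). \<forall>i\<in>{1..n}. \<forall>c. \<forall>x\<in>X i.
           T (u(i := smulX c x)) = smulY c (T (u(i := x)))) \<and>
        bounded (T ` unit_ball_prod n X)}"

definition form_ball ::
    "('k::{real_normed_field,euclidean_space} \<Rightarrow> 'a::real_normed_vector \<Rightarrow> 'a)
      \<Rightarrow> nat \<Rightarrow> (nat \<Rightarrow> 'a set) \<Rightarrow> ((nat \<Rightarrow> 'a) \<Rightarrow> 'k) set" where
  "form_ball smulX n X =
     {\<phi> \<in> bounded_multilinear smulX (*) n X. (SUP u\<in>unit_ball_prod n X. norm (\<phi> u)) \<le> 1}"

text \<open>
  The supremum over \<open>form_ball\<close> is a genuine real supremum: each form satisfies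
  \<open>\<bar>\<phi>(u)\<bar> \<le> \<Prod>\<parallel>u\<^sub>i\<parallel>\<close>, and the zero form belongs to the ball.
\<close>

definition Pi_Lip ::
    "real \<Rightarrow> ('k::{real_normed_field,euclidean_space} \<Rightarrow> 'a::real_normed_vector \<Rightarrow> 'a)
      \<Rightarrow> ('k \<Rightarrow> 'b::real_normed_vector \<Rightarrow> 'b) \<Rightarrow> nat \<Rightarrow> (nat \<Rightarrow> 'a set) \<Rightarrow> ((nat \<Rightarrow> 'a) \<Rightarrow> 'b) set" where
  "Pi_Lip p smulX smulY n X =
     {T \<in> bounded_multilinear smulX smulY n X.
        \<exists>c>0. \<forall>(k::nat) u v.
          (\<forall>i\<in>{1..k}. u i \<in> (\<Pi>\<^sub>E j\<in>{1..n}. X j) \<and> v i \<in> (\<Pi>\<^sub>E j\<in>{1..n}. X j)) \<longrightarrow>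
          (\<Sum>i=1..k. norm (T (u i) - T (v i)) powr p) powr (1 / p)
            \<le> c * (SUP \<phi>\<in>form_ball smulX n X.
                      (\<Sum>i=1..k. norm (\<phi> (u i) - \<phi> (v i)) powr p) powr (1 / p))}"

end

theory Submission imports Defs begin

text \<open>
  A summing inequality for \<open>T\<close> involves the points only through the differences \<open>\<delta>\<^sub>i\<close> of the elementary
  tensors \<open>u\<^sub>i\<close> and \<open>v\<^sub>i\<close>, and a scalar multiple of such a difference is again one
  (\<open>multilinear_on_scale_first\<close>).  This homogeneity is all of linearity that the classical comparison of 1-summing and
  2-summing operators uses.  It gives at once that 1-summing implies 2-summing, for any spaces.

  For the converse it suffices to write \<open>\<delta>\<^sub>i = \<surd>h\<^sub>i z\<^sub>i\<close>, where \<open>\<Sum>h\<^sub>i\<close> and the square of the weak \<open>\<ell>\<^sub>2\<close>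
  norm of \<open>(z\<^sub>i)\<close> are controlled by the weak \<open>\<ell>\<^sub>1\<close> norm of \<open>(\<delta>\<^sub>i)\<close>; the rest is the Cauchy-Schwarz inequality.
  Such a factorisation exists in \<open>L\<^sub>1\<close> spaces because operators from \<open>c\<^sub>0\<close> to \<open>L\<^sub>1\<close> are 2-summing, by
  Grothendieck's theorem, and the projective tensor product of \<open>L\<^sub>1\<close> spaces is of the same kind.  The tensor
  product is not constructed.  Evaluating forms at the \<open>\<delta>\<^sub>i\<close> is described by a scalar matrix, after two
  reductions: a compactness argument (\<open>form_ball_localizes\<close>) passes to finite-dimensional subspaces, and there the
  coordinates of \<open>script_L1_space_coordinates\<close> identify the ball of forms, up to a constant, with the
  arrays of scalars of modulus at most 1.

  For matrices, Grothendieck's inequality (\<open>grothendieck_inequality\<close>) is proved by truncating random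
  signed sums, and the weights \<open>h\<close> are read off from the solution of an extremal problem
  (\<open>change_of_density\<close>).  The scalar field enters through its norm, which is multiplicative and
  comes from an inner product, so that real and complex scalars are treated together.
\<close>

section \<open>Moments of random signed sums\<close>

text \<open>
  The list of all \<open>2 ^ M\<close> combinations \<open>\<plusminus>f\<^sub>1 \<plusminus> \<dots> \<plusminus> f\<^sub>M\<close>: summing over it and dividing by
  \<open>2 ^ M\<close> is the expectation over independent random signs, with no probability space involved.
\<close>

fun signed_sums :: "('j \<Rightarrow> 'v::ab_group_add) list \<Rightarrow> ('j \<Rightarrow> 'v) list" where
  "signed_sums [] = [\<lambda>j. 0]"
| "signed_sums (f # fs) =
     map (\<lambda>g j. g j + f j) (signed_sums fs) @ map (\<lambda>g j. g j - f j) (signed_sums fs)"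

lemma length_signed_sums: "length (signed_sums fs) = 2 ^ length fs"
  by (induction fs) auto

text \<open>
  The two moment computations add one random sign at a time.  Odd powers of the new sign cancel, so
  the second moment reproduces itself by the parallelogram law.
\<close>

lemma signed_sums_second_moment:
  fixes L :: "('j \<Rightarrow> 'v::ab_group_add) \<Rightarrow> 'w::real_inner"
  assumes add: "\<And>f g. L (\<lambda>j. f j + g j) = L f + L g"
    and diff: "\<And>f g. L (\<lambda>j. f j - g j) = L f - L g"
  shows "(\<Sum>g\<leftarrow>signed_sums fs. (norm (L g))\<^sup>2) = 2 ^ length fs * (\<Sum>f\<leftarrow>fs. (norm (L f))\<^sup>2)"
proof (induction fs)
  case Nil
  show ?case using diff[of "\<lambda>_. 0" "\<lambda>_. 0"] by simp
next
  case (Cons f fs)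
  have parallelogram: "(norm (x + y))\<^sup>2 + (norm (x - y))\<^sup>2 = 2 * (norm x)\<^sup>2 + 2 * (norm y)\<^sup>2"
    for x y :: 'w
    by (simp add: power2_norm_eq_inner inner_simps)
  have "(\<Sum>g\<leftarrow>signed_sums (f # fs). (norm (L g))\<^sup>2)
      = (\<Sum>g\<leftarrow>signed_sums fs. (norm (L g + L f))\<^sup>2 + (norm (L g - L f))\<^sup>2)"
    by (simp add: o_def add diff sum_list_addf)
  also have "\<dots> = 2 * (\<Sum>g\<leftarrow>signed_sums fs. (norm (L g))\<^sup>2)
                + 2 * (2 ^ length fs * (norm (L f))\<^sup>2)"
    by (simp only: parallelogram sum_list_addf sum_list_const_mult sum_list_triv)
       (simp add: sum_list_triv length_signed_sums)
  finally show ?case using Cons by (simp add: algebra_simps)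
qed

text \<open>
  With \<open>A\<close> the sum of the squares so far and \<open>y\<close> the new vector, the fourth moment grows from at most
  \<open>3 A\<^sup>2\<close> by at most \<open>6 A \<parallel>y\<parallel>\<^sup>2 + \<parallel>y\<parallel>\<^sup>4\<close>, which is below \<open>3 (A + \<parallel>y\<parallel>\<^sup>2)\<^sup>2 - 3 A\<^sup>2\<close>.  The constant 3 is the fourth
  moment of a normalised Gaussian.
\<close>

lemma signed_sums_fourth_moment:
  fixes L :: "('j \<Rightarrow> 'v::ab_group_add) \<Rightarrow> 'w::real_inner"
  assumes add: "\<And>f g. L (\<lambda>j. f j + g j) = L f + L g"
    and diff: "\<And>f g. L (\<lambda>j. f j - g j) = L f - L g"
  shows "(\<Sum>g\<leftarrow>signed_sums fs. (norm (L g)) ^ 4)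
           \<le> 3 * 2 ^ length fs * (\<Sum>f\<leftarrow>fs. (norm (L f))\<^sup>2)\<^sup>2"
proof (induction fs)
  case Nil
  show ?case using diff[of "\<lambda>_. 0" "\<lambda>_. 0"] by simp
next
  case (Cons f fs)
  have two_signs: "norm (x + y) ^ 4 + norm (x - y) ^ 4
      \<le> 2 * norm x ^ 4 + 12 * (norm y)\<^sup>2 * (norm x)\<^sup>2 + 2 * norm y ^ 4" for x y :: 'w
  proof -
    have p: "(norm (x + y))\<^sup>2 = (norm x)\<^sup>2 + (norm y)\<^sup>2 + 2 * (x \<bullet> y)"
      and m: "(norm (x - y))\<^sup>2 = (norm x)\<^sup>2 + (norm y)\<^sup>2 - 2 * (x \<bullet> y)"
      by (simp_all add: power2_norm_eq_inner inner_simps inner_commute)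
    have e: "z ^ 4 = (z\<^sup>2)\<^sup>2" for z :: real by simp
    have "(x \<bullet> y)\<^sup>2 \<le> (norm x)\<^sup>2 * (norm y)\<^sup>2"
      using Cauchy_Schwarz_ineq[of x y] by (simp add: power2_norm_eq_inner)
    then show ?thesis
      unfolding e p m by (simp add: power2_eq_square algebra_simps)
  qed
  let ?A = "\<Sum>f\<leftarrow>fs. (norm (L f))\<^sup>2"
  let ?c = "(norm (L f))\<^sup>2"
  have "(\<Sum>g\<leftarrow>signed_sums (f # fs). norm (L g) ^ 4)
      = (\<Sum>g\<leftarrow>signed_sums fs. norm (L g + L f) ^ 4 + norm (L g - L f) ^ 4)"
    by (simp add: o_def add diff sum_list_addf)
  also have "\<dots> \<le> (\<Sum>g\<leftarrow>signed_sums fs.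
      2 * norm (L g) ^ 4 + 12 * (norm (L f))\<^sup>2 * (norm (L g))\<^sup>2 + 2 * norm (L f) ^ 4)"
    by (intro sum_list_mono two_signs)
  also have "\<dots> = 2 * (\<Sum>g\<leftarrow>signed_sums fs. norm (L g) ^ 4)
      + 12 * ?c * (2 ^ length fs * ?A) + 2 ^ length fs * (2 * norm (L f) ^ 4)"
    unfolding signed_sums_second_moment[where L=L, OF add diff, symmetric]
    by (simp only: sum_list_addf sum_list_const_mult sum_list_triv)
       (simp add: sum_list_triv length_signed_sums)
  also have "\<dots> \<le> 2 * (3 * 2 ^ length fs * ?A\<^sup>2)
      + 12 * ?c * (2 ^ length fs * ?A) + 2 ^ length fs * (6 * norm (L f) ^ 4)"
    using Cons by (intro add_mono mult_left_mono) auto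
  also have "\<dots> = 3 * 2 ^ length (f # fs) * (?c + ?A)\<^sup>2"
    by (simp add: power2_eq_square algebra_simps power4_eq_xxxx)
  finally show ?case by simp
qed

text \<open>
  Khinchine's inequality between the first and second moments.  A fourth moment bound prevents a
  variable from living on a small set, hence bounds its first moment below: integrate a pointwise
  inequality \<open>x \<ge> \<alpha> x\<^sup>2 - \<beta> x\<^sup>4\<close>.
\<close>

lemma khinchine_L1_L2:
  fixes L :: "('j \<Rightarrow> 'v::ab_group_add) \<Rightarrow> 'w::real_inner"
  assumes add: "\<And>f g. L (\<lambda>j. f j + g j) = L f + L g"
    and diff: "\<And>f g. L (\<lambda>j. f j - g j) = L f - L g"
  shows "2 ^ length fs * sqrt (\<Sum>f\<leftarrow>fs. (norm (L f))\<^sup>2)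
           \<le> 2 * (\<Sum>g\<leftarrow>signed_sums fs. norm (L g))"
proof -
  define s where "s = sqrt (\<Sum>f\<leftarrow>fs. (norm (L f))\<^sup>2)"
  define N :: real where "N = 2 ^ length fs"
  have s2: "s\<^sup>2 = (\<Sum>f\<leftarrow>fs. (norm (L f))\<^sup>2)"
    unfolding s_def by (intro real_sqrt_pow2 sum_list_nonneg) auto
  show ?thesis
  proof (cases "s = 0")
    case True
    then show ?thesis unfolding s_def by (auto intro!: sum_list_nonneg)
  next
    case False
    then have s: "s > 0"
      unfolding s_def by (auto simp: order_less_le intro!: sum_list_nonneg)
    have pw: "12 * s ^ 3 * x \<ge> 9 * s\<^sup>2 * x\<^sup>2 - x ^ 4" if "x \<ge> 0" for x :: real
    proof -
      \<comment> \<open>The cubic has its minimum at \<open>x = \<surd>3 s\<close>; \<open>7/4\<close> is a rational point close to \<open>\<surd>3\<close>.\<close>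
      have "x ^ 3 - 9 * s\<^sup>2 * x + 12 * s ^ 3
          = (x - 7/4 * s)\<^sup>2 * (x + 7/2 * s) + 3/16 * s\<^sup>2 * x + 41/32 * s ^ 3"
        by (simp add: power2_eq_square power3_eq_cube field_simps)
      also have "\<dots> \<ge> 0" using s that by (intro add_nonneg_nonneg mult_nonneg_nonneg) auto
      finally have "x * (x ^ 3 - 9 * s\<^sup>2 * x + 12 * s ^ 3) \<ge> 0" using that by simp
      then show ?thesis by (simp add: power2_eq_square power3_eq_cube power4_eq_xxxx algebra_simps)
    qed
    have "9 * s\<^sup>2 * (N * s\<^sup>2) - 3 * N * (s\<^sup>2)\<^sup>2
        \<le> 9 * s\<^sup>2 * (\<Sum>g\<leftarrow>signed_sums fs. (norm (L g))\<^sup>2)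
            - (\<Sum>g\<leftarrow>signed_sums fs. norm (L g) ^ 4)"
      using signed_sums_second_moment[where L=L and fs=fs, OF add diff]
        signed_sums_fourth_moment[where L=L and fs=fs, OF add diff]
      unfolding s2 N_def by simp
    also have "\<dots> = (\<Sum>g\<leftarrow>signed_sums fs. 9 * s\<^sup>2 * (norm (L g))\<^sup>2 - norm (L g) ^ 4)"
      by (simp only: sum_list_subtractf sum_list_const_mult)
    also have "\<dots> \<le> (\<Sum>g\<leftarrow>signed_sums fs. 12 * s ^ 3 * norm (L g))"
      by (intro sum_list_mono pw) auto
    also have "\<dots> = 12 * s ^ 3 * (\<Sum>g\<leftarrow>signed_sums fs. norm (L g))"
      by (simp only: sum_list_const_mult)
    finally have "6 * s ^ 3 * (N * s) \<le> 6 * s ^ 3 * (2 * (\<Sum>g\<leftarrow>signed_sums fs. norm (L g)))"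
      by (simp add: power2_eq_square power3_eq_cube algebra_simps)
    then have "N * s \<le> 2 * (\<Sum>g\<leftarrow>signed_sums fs. norm (L g))"
      using s by (subst (asm) mult_le_cancel_left_pos) auto
    then show ?thesis unfolding N_def s_def .
  qed
qed

section \<open>Grothendieck's inequality\<close>

definition functional :: "'j set \<Rightarrow> ('i \<Rightarrow> 'j \<Rightarrow> 'k::comm_ring) \<Rightarrow> 'i \<Rightarrow> ('j \<Rightarrow> 'k) \<Rightarrow> 'k" where
  "functional J a i t = (\<Sum>j\<in>J. a i j * t j)"

text \<open>
  A list of families \<open>f\<^sub>1, \<dots>, f\<^sub>M\<close> stands for the family of vectors \<open>(f\<^sub>1 j, \<dots>, f\<^sub>M j)\<close> of the Hilbert
  space \<open>\<ell>\<^sub>2\<^sup>M\<close>, indexed by \<open>j\<close>.  Lists keep \<open>M\<close> free, so that dimensions can be changed by appending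
  and mapping.
\<close>

definition l2_bounded :: "'j set \<Rightarrow> ('j \<Rightarrow> 'k::real_normed_vector) list \<Rightarrow> bool" where
  "l2_bounded J fs \<longleftrightarrow> (\<forall>j\<in>J. (\<Sum>f\<leftarrow>fs. (norm (f j))\<^sup>2) \<le> 1)"

definition square_sum ::
    "'j set \<Rightarrow> ('i \<Rightarrow> 'j \<Rightarrow> 'k::real_normed_field) \<Rightarrow> ('j \<Rightarrow> 'k) list \<Rightarrow> 'i \<Rightarrow> real" where
  "square_sum J a fs i = (\<Sum>f\<leftarrow>fs. (norm (functional J a i f))\<^sup>2)"

lemma functional_add: "functional J a i (\<lambda>j. f j + g j) = functional J a i f + functional J a i g"
  by (simp add: functional_def distrib_left sum.distrib)

lemma functional_diff: "functional J a i (\<lambda>j. f j - g j) = functional J a i f - functional J a i g"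
  by (simp add: functional_def right_diff_distrib sum_subtractf)

lemma functional_scale: "functional J a i (\<lambda>j. c * f j) = c * functional J a i f"
  by (simp add: functional_def sum_distrib_left algebra_simps)

lemma square_sum_nonneg: "square_sum J a fs i \<ge> 0"
  unfolding square_sum_def by (auto intro!: sum_list_nonneg)

text \<open>
  A crude a priori bound, which makes suprema over all \<open>l2_bounded\<close> lists finite: the self-improving
  argument for Grothendieck's inequality absorbs such a supremum, and the optimisation after it approximates one.
\<close>

lemma square_sum_le:
  fixes a :: "'i \<Rightarrow> 'j \<Rightarrow> 'k::real_normed_field"
  assumes "l2_bounded J fs"
  shows "square_sum J a fs i \<le> (\<Sum>j\<in>J. (norm (a i j))\<^sup>2) * card J"
proof -
  have "(norm (functional J a i f))\<^sup>2 \<le> (\<Sum>j\<in>J. (norm (a i j))\<^sup>2) * (\<Sum>j\<in>J. (norm (f j))\<^sup>2)" for f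
  proof -
    have "norm (functional J a i f) \<le> (\<Sum>j\<in>J. norm (a i j) * norm (f j))"
      unfolding functional_def by (rule sum_norm_le) (simp add: norm_mult)
    then have "(norm (functional J a i f))\<^sup>2 \<le> (\<Sum>j\<in>J. norm (a i j) * norm (f j))\<^sup>2"
      by (rule power_mono) simp
    also have "\<dots> \<le> (\<Sum>j\<in>J. (norm (a i j))\<^sup>2) * (\<Sum>j\<in>J. (norm (f j))\<^sup>2)"
      by (rule Cauchy_Schwarz_ineq_sum)
    finally show ?thesis .
  qed
  then have "square_sum J a fs i
      \<le> (\<Sum>f\<leftarrow>fs. (\<Sum>j\<in>J. (norm (a i j))\<^sup>2) * (\<Sum>j\<in>J. (norm (f j))\<^sup>2))"
    unfolding square_sum_def by (intro sum_list_mono)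
  also have "\<dots> = (\<Sum>j\<in>J. (norm (a i j))\<^sup>2) * (\<Sum>j\<in>J. \<Sum>f\<leftarrow>fs. (norm (f j))\<^sup>2)"
    by (induction fs) (simp_all add: distrib_left sum.distrib)
  also have "\<dots> \<le> (\<Sum>j\<in>J. (norm (a i j))\<^sup>2) * (\<Sum>j\<in>J. 1)"
    using assms unfolding l2_bounded_def
    by (intro mult_left_mono sum_mono sum_nonneg) auto
  finally show ?thesis by simp
qed

lemma sum_list_power2_le:
  fixes f :: "'x \<Rightarrow> real"
  shows "(\<Sum>x\<leftarrow>xs. f x)\<^sup>2 \<le> length xs * (\<Sum>x\<leftarrow>xs. (f x)\<^sup>2)"
proof -
  have "(\<Sum>i<length xs. f (xs ! i) * 1)\<^sup>2
      \<le> (\<Sum>i<length xs. (f (xs ! i))\<^sup>2) * (\<Sum>i<length xs. 1\<^sup>2)"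
    by (rule Cauchy_Schwarz_ineq_sum)
  then show ?thesis
    by (simp add: sum_list_sum_nth atLeast0LessThan mult.commute)
qed

lemma sum_sum_list_swap: "(\<Sum>i\<in>I. \<Sum>x\<leftarrow>xs. h i x) = (\<Sum>x\<leftarrow>xs. \<Sum>i\<in>I. h i x)"
  for h :: "_ \<Rightarrow> _ \<Rightarrow> 'c::comm_monoid_add"
  by (induction xs) (simp_all add: sum.distrib)

text \<open>
  Grothendieck's inequality: an estimate for scalar families \<open>t\<close> in the unit ball of \<open>\<ell>\<^sub>\<infinity>\<close> extends, up to a
  universal constant, to families of Hilbert space vectors.  Let \<open>S\<close> be the best constant.  By
  Khinchine's inequality the vectors may be replaced by the scalar random families \<open>g\<close> given by signed sums.
  These are bounded only in mean square; cut them at height 6.  The small part is covered by the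
  hypothesis, while by the fourth moment bound the large part has mean square norm at most \<open>1/3\<close>, so
  it is again a Hilbert space family to which the constant \<open>S\<close> applies.  This gives
  \<open>S \<le> 2 (6 W + S / 3)\<close>, and \<open>S\<close> can be absorbed.
\<close>

theorem grothendieck_inequality:
  fixes a :: "'i \<Rightarrow> 'j \<Rightarrow> 'k::{real_normed_field,real_inner}"
  assumes bound: "\<And>t. (\<And>j. j \<in> J \<Longrightarrow> norm (t j) \<le> 1) \<Longrightarrow> (\<Sum>i\<in>I. norm (functional J a i t)) \<le> W"
    and fs: "l2_bounded J fs"
  shows "(\<Sum>i\<in>I. sqrt (square_sum J a fs i)) \<le> 36 * W"
proof -
  define G where "G fs = (\<Sum>i\<in>I. sqrt (square_sum J a fs i))" for fs
  define S where "S = (SUP fs\<in>Collect (l2_bounded J). G fs)"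
  have bdd: "bdd_above (G ` Collect (l2_bounded J))"
    unfolding G_def
    by (intro bdd_aboveI2[where M="\<Sum>i\<in>I. sqrt ((\<Sum>j\<in>J. (norm (a i j))\<^sup>2) * card J)"] sum_mono
        real_sqrt_le_mono square_sum_le) simp
  have G_le_S: "G fs \<le> S" if "l2_bounded J fs" for fs
    unfolding S_def by (rule cSUP_upper[OF _ bdd]) (simp add: that)
  have improve: "G fs \<le> 2 * (6 * W + S / 3)" if fs: "l2_bounded J fs" for fs
  proof -
    let ?N = "2 ^ length fs :: real"
    let ?gs = "signed_sums fs"
    let ?L = "functional J a"
    define small where "small g j = (if norm (g j) \<le> 6 then g j else 0)" for g :: "'j \<Rightarrow> 'k" and j
    define large where "large g j = (if norm (g j) \<le> 6 then 0 else g j)" for g :: "'j \<Rightarrow> 'k" and j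
    \<comment> \<open>The large parts as one Hilbert space family: \<open>1 / \<surd>N\<close> turns the sum over the \<open>N\<close> sign
      patterns into a mean, and the factor 3 is what the fourth moment bound \<open>3 / 6\<^sup>2 \<le> 1 / 3\<^sup>2\<close> leaves room for.\<close>
    define hs where "hs = map (\<lambda>g j. of_real (3 / sqrt ?N) * large g j) ?gs"
    have split: "?L i g = ?L i (small g) + ?L i (large g)" for i g
      unfolding functional_add[symmetric] by (rule arg_cong[of _ _ "?L i"]) (auto simp: small_def large_def)
    have triangle: "norm (?L i g) \<le> norm (?L i (small g)) + norm (?L i (large g))" for i g
      by (subst split) (rule norm_triangle_ineq)
    have small: "(\<Sum>i\<in>I. norm (?L i (small g))) \<le> 6 * W" for g
    proof -
      have "(\<Sum>i\<in>I. norm (?L i (\<lambda>j. of_real (1/6) * small g j))) \<le> W"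
        by (rule bound) (simp add: small_def norm_mult norm_divide)
      then show ?thesis
        unfolding functional_scale norm_mult sum_distrib_left[symmetric] norm_of_real by simp
    qed
    have hs: "l2_bounded J hs"
      unfolding l2_bounded_def
    proof
      fix j assume j: "j \<in> J"
      have tail: "(norm (large g j))\<^sup>2 \<le> norm (g j) ^ 4 / 36" for g
      proof (cases "norm (g j) \<le> 6")
        case False
        then have "36 * (norm (g j))\<^sup>2 \<le> (norm (g j))\<^sup>2 * (norm (g j))\<^sup>2"
          using power_mono[of 6 "norm (g j)" 2] by (intro mult_right_mono) auto
        then show ?thesis using False by (simp add: large_def power4_eq_xxxx power2_eq_square mult.assoc)
      qed (simp add: large_def)
      have "(\<Sum>f\<leftarrow>hs. (norm (f j))\<^sup>2) = (\<Sum>g\<leftarrow>?gs. 9 / ?N * (norm (large g j))\<^sup>2)"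
        unfolding hs_def by (simp add: o_def norm_mult norm_divide power_mult_distrib power_divide)
      also have "\<dots> \<le> (\<Sum>g\<leftarrow>?gs. 9 / ?N * (norm (g j) ^ 4 / 36))"
        by (intro sum_list_mono mult_left_mono tail) simp
      also have "\<dots> = 1 / (4 * ?N) * (\<Sum>g\<leftarrow>?gs. norm (g j) ^ 4)"
        unfolding sum_list_const_mult[symmetric] by (rule arg_cong[of _ _ sum_list]) simp
      also have "\<dots> \<le> 1 / (4 * ?N) * (3 * ?N * (\<Sum>f\<leftarrow>fs. (norm (f j))\<^sup>2)\<^sup>2)"
        by (intro mult_left_mono signed_sums_fourth_moment[where L="\<lambda>f. f j"]) simp_all
      also have "\<dots> = 3 / 4 * (\<Sum>f\<leftarrow>fs. (norm (f j))\<^sup>2)\<^sup>2"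
        by simp
      also have "\<dots> \<le> 3 / 4 * 1\<^sup>2"
        using fs j unfolding l2_bounded_def
        by (intro mult_left_mono power_mono sum_list_nonneg) auto
      finally show "(\<Sum>f\<leftarrow>hs. (norm (f j))\<^sup>2) \<le> 1" by simp
    qed
    have large: "(\<Sum>g\<leftarrow>?gs. norm (?L i (large g))) \<le> ?N / 3 * sqrt (square_sum J a hs i)" for i
    proof -
      have sq: "square_sum J a hs i = 9 / ?N * (\<Sum>g\<leftarrow>?gs. (norm (?L i (large g)))\<^sup>2)"
      proof -
        have "square_sum J a hs i = (\<Sum>g\<leftarrow>?gs. (norm (?L i (\<lambda>j. of_real (3 / sqrt ?N) * large g j)))\<^sup>2)"
          unfolding square_sum_def hs_def by (simp add: o_def)
        also have "\<dots> = (\<Sum>g\<leftarrow>?gs. 9 / ?N * (norm (?L i (large g)))\<^sup>2)"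
          by (simp only: functional_scale norm_mult norm_of_real power_mult_distrib power2_abs)
             (simp add: power_divide)
        finally show ?thesis by (simp only: sum_list_const_mult)
      qed
      have "(\<Sum>g\<leftarrow>?gs. norm (?L i (large g)))\<^sup>2 \<le> ?N * (\<Sum>g\<leftarrow>?gs. (norm (?L i (large g)))\<^sup>2)"
        using sum_list_power2_le[of "\<lambda>g. norm (?L i (large g))" ?gs] by (simp add: length_signed_sums)
      also have "\<dots> = (?N / 3 * sqrt (square_sum J a hs i))\<^sup>2"
        using square_sum_nonneg[of J a hs i]
        by (simp add: power_mult_distrib power_divide sq) (simp add: power2_eq_square)
      finally show ?thesis
        by (rule power2_le_imp_le) (simp add: square_sum_nonneg)
    qed
    have "?N * G fs \<le> (\<Sum>i\<in>I. 2 * (\<Sum>g\<leftarrow>?gs. norm (?L i g)))"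
      unfolding G_def sum_distrib_left square_sum_def
      by (intro sum_mono khinchine_L1_L2 functional_add functional_diff)
    also have "\<dots> \<le> (\<Sum>i\<in>I. 2 * (\<Sum>g\<leftarrow>?gs. norm (?L i (small g)) + norm (?L i (large g))))"
      by (intro sum_mono mult_left_mono sum_list_mono triangle) simp
    also have "\<dots> = 2 * ((\<Sum>g\<leftarrow>?gs. \<Sum>i\<in>I. norm (?L i (small g)))
                      + (\<Sum>i\<in>I. \<Sum>g\<leftarrow>?gs. norm (?L i (large g))))"
      by (simp only: sum_distrib_left[symmetric] sum_list_addf sum.distrib sum_sum_list_swap)
    also have "\<dots> \<le> 2 * ((\<Sum>g\<leftarrow>?gs. 6 * W) + (\<Sum>i\<in>I. ?N / 3 * sqrt (square_sum J a hs i)))"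
      by (intro mult_left_mono add_mono sum_list_mono small sum_mono large) simp
    also have "\<dots> = 2 * (?N * (6 * W) + ?N / 3 * G hs)"
      unfolding G_def sum_distrib_left[symmetric] by (simp add: sum_list_triv length_signed_sums)
    also have "\<dots> \<le> 2 * (?N * (6 * W) + ?N / 3 * S)"
      by (intro mult_left_mono add_mono G_le_S hs order_refl) simp_all
    also have "\<dots> = ?N * (2 * (6 * W + S / 3))" by (simp add: algebra_simps)
    finally show ?thesis by (subst (asm) mult_le_cancel_left_pos) simp_all
  qed
  have "S \<le> 2 * (6 * W + S / 3)"
    unfolding S_def
    by (rule cSUP_least) (use fs improve[unfolded S_def] in auto)
  then have "S \<le> 36 * W" by simp
  with G_le_S[OF fs] show ?thesis unfolding G_def by simp
qed

section \<open>Factorisation through a weighted Hilbert space\<close>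

text \<open>
  The vectors \<open>square_sum J a fs\<close>, for \<open>l2_bounded\<close> lists \<open>fs\<close>, form a convex set: join the lists,
  scaled by \<open>\<surd>(1 - s)\<close> and \<open>\<surd>s\<close>.
\<close>

lemma square_sum_mix:
  assumes s: "0 \<le> s" "s \<le> 1" and fs: "l2_bounded J fs" and gs: "l2_bounded J gs"
  obtains hs where "l2_bounded J hs"
    and "\<And>i. square_sum J a hs i = (1 - s) * square_sum J a fs i + s * square_sum J a gs i"
proof
  define hs where "hs = map (\<lambda>f j. of_real (sqrt (1 - s)) * f j) fs @ map (\<lambda>g j. of_real (sqrt s) * g j) gs"
  show "l2_bounded J hs"
    unfolding l2_bounded_def
  proof
    fix j assume j: "j \<in> J"
    have "(\<Sum>f\<leftarrow>hs. (norm (f j))\<^sup>2) = (1 - s) * (\<Sum>f\<leftarrow>fs. (norm (f j))\<^sup>2) + s * (\<Sum>g\<leftarrow>gs. (norm (g j))\<^sup>2)"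
      unfolding hs_def using s
      by (simp add: o_def norm_mult power_mult_distrib sum_list_const_mult)
    also have "\<dots> \<le> (1 - s) * 1 + s * 1"
      using s fs gs j unfolding l2_bounded_def by (intro add_mono mult_left_mono) auto
    finally show "(\<Sum>f\<leftarrow>hs. (norm (f j))\<^sup>2) \<le> 1" by simp
  qed
  show "square_sum J a hs i = (1 - s) * square_sum J a fs i + s * square_sum J a gs i" for i
    unfolding square_sum_def hs_def map_append map_map o_def functional_scale using s
    by (simp add: norm_mult power_mult_distrib sum_list_const_mult)
qed

text \<open>A first order expansion of \<open>\<surd>(p + \<epsilon>)\<close> with an error quadratic in \<open>r - p\<close>, uniformly in \<open>p \<ge> 0\<close>.\<close>

lemma sqrt_second_order:
  fixes p r \<epsilon> :: real
  assumes "\<epsilon> > 0" "p \<ge> 0" "r \<ge> 0"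
  shows "(r - p) / (2 * sqrt (p + \<epsilon>)) - (r - p)\<^sup>2 / (2 * \<epsilon> * sqrt \<epsilon>) \<le> sqrt (r + \<epsilon>) - sqrt (p + \<epsilon>)"
proof -
  define x where "x = sqrt (p + \<epsilon>)"
  define y where "y = sqrt (r + \<epsilon>)"
  define e where "e = sqrt \<epsilon>"
  have e: "e > 0" "x \<ge> e" "y \<ge> e" using assms by (auto simp: x_def y_def e_def)
  have p: "p = x\<^sup>2 - \<epsilon>" and r: "r = y\<^sup>2 - \<epsilon>" and ee: "\<epsilon> = e\<^sup>2"
    using assms by (simp_all add: x_def y_def e_def)
  have rp: "r - p = (y - x) * (y + x)" unfolding p r by (simp add: power2_eq_square algebra_simps)
  have "(r - p) / (2 * x) - (y - x) = (y - x)\<^sup>2 / (2 * x)"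
    using e unfolding rp by (simp add: field_simps power2_eq_square)
  also have "\<dots> = (y - x)\<^sup>2 * 1 / (2 * x)" by simp
  also have "\<dots> \<le> (y - x)\<^sup>2 * ((y + x)\<^sup>2 / e\<^sup>2) / (2 * e)"
  proof (intro frac_le mult_left_mono)
    have "e\<^sup>2 \<le> (y + x)\<^sup>2" using e by (intro power_mono) auto
    then show "1 \<le> (y + x)\<^sup>2 / e\<^sup>2" using e by simp
  qed (use e in auto)
  also have "\<dots> = (r - p)\<^sup>2 / (2 * \<epsilon> * e)"
    unfolding rp ee by (simp add: power_mult_distrib)
  finally show ?thesis unfolding x_def[symmetric] y_def[symmetric] e_def[symmetric] by simp
qed

text \<open>
  The matrix \<open>a\<close> is an operator from \<open>\<ell>\<^sub>\<infinity>\<close> to \<open>\<ell>\<^sub>1\<close>, and the claim is that it factors through a weighted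
  \<open>\<ell>\<^sub>2\<close>; equivalently, its adjoint is 2-summing.  The usual route from Grothendieck's
  inequality is a separation theorem.  Here the weights come from an extremal problem instead: let
  \<open>p\<close> maximise \<open>\<Sum>\<surd>p\<^sub>i\<close> over the convex set of vectors \<open>square_sum J a fs\<close> and put \<open>h\<^sub>i = \<surd>p\<^sub>i\<close>.
  Grothendieck's inequality bounds the maximum, that is \<open>\<Sum>h\<^sub>i\<close>.  The first order condition at the maximum reads
  \<open>\<Sum>q\<^sub>i / h\<^sub>i \<le> \<Sum>p\<^sub>i / h\<^sub>i = \<Sum>h\<^sub>i\<close> for all \<open>q\<close> in the set, in particular for \<open>q\<^sub>i = |\<langle>a\<^sub>i, t\<rangle>|\<^sup>2\<close>.  To
  have positive weights and to avoid a compactness argument, \<open>p\<^sub>i\<close> is replaced by \<open>p\<^sub>i + \<epsilon>\<close> and the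
  maximiser by an almost maximiser; this costs \<open>\<eta>\<close>.
\<close>

theorem change_of_density:
  fixes a :: "'i \<Rightarrow> 'j \<Rightarrow> 'k::{real_normed_field,real_inner}"
  assumes bound: "\<And>t. (\<And>j. j \<in> J \<Longrightarrow> norm (t j) \<le> 1) \<Longrightarrow> (\<Sum>i\<in>I. norm (functional J a i t)) \<le> W"
    and "\<eta> > 0"
  obtains h :: "'i \<Rightarrow> real"
  where "\<And>i. h i > 0" and "(\<Sum>i\<in>I. h i) \<le> 36 * W + \<eta>"
    and "\<And>t. (\<And>j. j \<in> J \<Longrightarrow> norm (t j) \<le> 1) \<Longrightarrow>
           (\<Sum>i\<in>I. (norm (functional J a i t))\<^sup>2 / h i) \<le> 36 * W + \<eta>"
proof -
  let ?q = "square_sum J a"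
  define \<delta> where "\<delta> = \<eta> / (2 * (card I + 1))"
  define \<epsilon> where "\<epsilon> = \<delta>\<^sup>2"
  have "\<delta> > 0" using \<open>\<eta> > 0\<close> by (simp add: \<delta>_def)
  then have \<delta>: "\<delta> > 0" "\<epsilon> > 0" "sqrt \<epsilon> = \<delta>" by (auto simp: \<epsilon>_def)
  have card_\<delta>: "card I * \<delta> \<le> \<eta> / 2"
    using \<open>\<eta> > 0\<close> by (simp add: \<delta>_def field_simps)
  define G where "G fs = (\<Sum>i\<in>I. sqrt (?q fs i + \<epsilon>))" for fs
  define S where "S = (SUP fs\<in>Collect (l2_bounded J). G fs)"
  have G_le: "G fs \<le> 36 * W + \<eta> / 2" if "l2_bounded J fs" for fs
  proof -
    have "G fs \<le> (\<Sum>i\<in>I. sqrt (?q fs i) + \<delta>)"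
      unfolding G_def \<delta>(3)[symmetric]
      by (intro sum_mono sqrt_add_le_add_sqrt square_sum_nonneg) (use \<delta> in auto)
    then show ?thesis
      using grothendieck_inequality[OF bound that] card_\<delta> by (simp add: sum.distrib)
  qed
  then have bdd: "bdd_above (G ` Collect (l2_bounded J))"
    by (intro bdd_aboveI2) auto
  have ne: "l2_bounded J []" by (simp add: l2_bounded_def)
  define M where "M = (\<Sum>i\<in>I. ((\<Sum>j\<in>J. (norm (a i j))\<^sup>2) * card J)\<^sup>2 / (2 * \<epsilon> * sqrt \<epsilon>))"
  have "M \<ge> 0" unfolding M_def using \<delta> by (intro sum_nonneg) auto
  \<comment> \<open>The step towards a competitor.  Being within \<open>s\<^sup>2\<close> of the supremum, the almost maximiser satisfies
    the first order condition up to an error of order \<open>s\<close>.\<close>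
  define s where "s = min 1 (\<eta> / (4 * (1 + M)))"
  have s: "0 < s" "s \<le> 1" and sM: "s * (1 + M) \<le> \<eta> / 4"
  proof -
    show "0 < s" "s \<le> 1" using \<open>\<eta> > 0\<close> \<open>M \<ge> 0\<close> by (auto simp: s_def)
    have "s * (1 + M) \<le> \<eta> / (4 * (1 + M)) * (1 + M)"
      using \<open>M \<ge> 0\<close> by (intro mult_right_mono) (auto simp: s_def)
    also have "\<dots> = \<eta> / 4" using \<open>M \<ge> 0\<close> by (simp add: field_simps)
    finally show "s * (1 + M) \<le> \<eta> / 4" .
  qed
  have "\<exists>fs\<in>Collect (l2_bounded J). S - s\<^sup>2 < G fs"
    unfolding S_def by (subst less_cSUP_iff[symmetric]) (use ne bdd s in auto)
  then obtain fs where fs: "l2_bounded J fs" and near: "S - s\<^sup>2 < G fs" by auto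
  define h where "h i = sqrt (?q fs i + \<epsilon>)" for i
  have h_pos: "h i > 0" for i
    unfolding h_def using \<delta> square_sum_nonneg[of J a fs i] by (simp add: add_nonneg_pos)
  have optimal: "(\<Sum>i\<in>I. ?q gs i / h i) \<le> G fs + \<eta> / 2" if gs: "l2_bounded J gs" for gs
  proof -
    obtain hs where hs: "l2_bounded J hs"
      and mix: "\<And>i. ?q hs i = (1 - s) * ?q fs i + s * ?q gs i"
      using square_sum_mix[of s J fs gs a] s fs gs by auto
    have diff: "?q hs i - ?q fs i = s * (?q gs i - ?q fs i)" for i
      by (simp add: mix algebra_simps)
    have increment: "s * ((?q gs i - ?q fs i) / (2 * h i))
        - s\<^sup>2 * (((\<Sum>j\<in>J. (norm (a i j))\<^sup>2) * card J)\<^sup>2 / (2 * \<epsilon> * sqrt \<epsilon>))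
        \<le> sqrt (?q hs i + \<epsilon>) - sqrt (?q fs i + \<epsilon>)" for i
    proof -
      let ?B = "(\<Sum>j\<in>J. (norm (a i j))\<^sup>2) * card J"
      have "\<bar>?q gs i - ?q fs i\<bar> \<le> ?B"
        using square_sum_le[OF fs, of a i] square_sum_le[OF gs, of a i]
          square_sum_nonneg[of J a fs i] square_sum_nonneg[of J a gs i] by linarith
      then have "(?q gs i - ?q fs i)\<^sup>2 \<le> ?B\<^sup>2"
        by (metis abs_ge_zero power2_abs power_mono)
      then have "s\<^sup>2 * ((?q gs i - ?q fs i)\<^sup>2 / (2 * \<epsilon> * sqrt \<epsilon>)) \<le> s\<^sup>2 * (?B\<^sup>2 / (2 * \<epsilon> * sqrt \<epsilon>))"
        using \<delta> by (intro mult_left_mono divide_right_mono) auto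
      then show ?thesis
        using sqrt_second_order[OF \<delta>(2) square_sum_nonneg[of J a fs i] square_sum_nonneg[of J a hs i]]
        unfolding diff h_def power_mult_distrib by simp
    qed
    have "s * (\<Sum>i\<in>I. (?q gs i - ?q fs i) / (2 * h i)) - s\<^sup>2 * M \<le> G hs - G fs"
      unfolding M_def G_def sum_distrib_left sum_subtractf[symmetric] by (intro sum_mono increment)
    moreover have "G hs \<le> S"
      unfolding S_def by (rule cSUP_upper[OF _ bdd]) (simp add: hs)
    ultimately have "s * (\<Sum>i\<in>I. (?q gs i - ?q fs i) / (2 * h i)) \<le> s * (s * (1 + M))"
      using near by (simp add: power2_eq_square algebra_simps)
    then have "(\<Sum>i\<in>I. (?q gs i - ?q fs i) / (2 * h i)) \<le> s * (1 + M)"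
      using s by (subst (asm) mult_le_cancel_left_pos) auto
    moreover have "(\<Sum>i\<in>I. (?q gs i - ?q fs i) / (2 * h i))
        = ((\<Sum>i\<in>I. ?q gs i / h i) - (\<Sum>i\<in>I. ?q fs i / h i)) / 2"
      by (simp add: diff_divide_distrib sum_subtractf sum_divide_distrib mult.commute)
    moreover have "(\<Sum>i\<in>I. ?q fs i / h i) \<le> G fs"
      unfolding G_def
    proof (rule sum_mono)
      fix i
      have "?q fs i \<le> (h i)\<^sup>2"
        unfolding h_def using \<delta> square_sum_nonneg[of J a fs i] by simp
      then show "?q fs i / h i \<le> sqrt (?q fs i + \<epsilon>)"
        using h_pos[of i] unfolding h_def[symmetric] by (simp add: pos_divide_le_eq power2_eq_square)
    qed
    ultimately show ?thesis using sM by simp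
  qed
  show thesis
  proof
    show "h i > 0" for i by (rule h_pos)
    show "(\<Sum>i\<in>I. h i) \<le> 36 * W + \<eta>"
      using G_le[OF fs] \<open>\<eta> > 0\<close> unfolding G_def h_def by simp
    fix t :: "'j \<Rightarrow> 'k" assume t: "\<And>j. j \<in> J \<Longrightarrow> norm (t j) \<le> 1"
    have "l2_bounded J [t]" using t by (simp add: l2_bounded_def power_le_one)
    from optimal[OF this] G_le[OF fs]
    show "(\<Sum>i\<in>I. (norm (functional J a i t))\<^sup>2 / h i) \<le> 36 * W + \<eta>"
      by (simp add: square_sum_def)
  qed
qed

section \<open>Coordinates on script-L1 spaces\<close>

lemma compact_PiE_UNIV:
  fixes S :: "'i \<Rightarrow> 'b::topological_space set"
  assumes "\<And>i. compact (S i)"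
  shows "compact (PiE UNIV S)"
proof -
  have "compactin (product_topology (\<lambda>_. euclidean) UNIV) (PiE UNIV S)"
    unfolding compactin_PiE using assms by simp
  then show ?thesis by (simp add: euclidean_product_topology)
qed

context normed_space_over
begin

lemma norm_smul_sum_le:
  "norm (\<Sum>l\<in>A. smul (z l) (b l)) \<le> (\<Sum>l\<in>A. norm (z l) * norm (b l))"
  by (rule sum_norm_le) (simp add: norm_smul)

lemma continuous_on_smul:
  assumes "continuous_on S f"
  shows "continuous_on S (\<lambda>z. smul (f z) b)"
proof -
  have "bounded_linear (\<lambda>c. smul c b)"
  proof (rule bounded_linear_intro)
    show "smul (r *\<^sub>R c) b = r *\<^sub>R smul c b" for r c
      by (simp add: scaleR_conv_of_real smul_of_real[symmetric])
    show "norm (smul c b) \<le> norm c * norm b" for c by (simp add: norm_smul)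
  qed (rule scale_left_distrib)
  then show ?thesis using assms by (rule bounded_linear.continuous_on)
qed

text \<open>
  An injective linear map from \<open>\<ell>\<^sub>1\<^sup>d\<close> into a normed space is bounded below, because its norm attains a
  positive minimum on the unit sphere, which is compact in the product topology.
\<close>

lemma l1_norm_le_norm:
  assumes inj: "\<And>z. z \<in> l1_carrier d \<Longrightarrow> (\<Sum>l=1..d. smul (z l) (b l)) = 0 \<Longrightarrow> z = (\<lambda>_. 0)"
  obtains A where "A > 0"
    and "\<And>z. z \<in> l1_carrier d \<Longrightarrow> l1_norm d z \<le> A * norm (\<Sum>l=1..d. smul (z l) (b l))"
proof -
  define f where "f z = (\<Sum>l=1..d. smul (z l) (b l))" for z
  define S where "S = {z :: nat \<Rightarrow> 'k. z \<in> l1_carrier d \<and> l1_norm d z = 1}"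
  have f_cont: "continuous_on UNIV f"
    unfolding f_def by (intro continuous_on_sum continuous_on_smul continuous_on_product_coordinates)
  have "compact S"
  proof -
    define P where "P = PiE UNIV (\<lambda>j. if j \<in> {1..d} then cball 0 1 else {0 :: 'k})"
    have "compact P" unfolding P_def by (rule compact_PiE_UNIV) simp
    moreover have "closed {z :: nat \<Rightarrow> 'k. l1_norm d z = 1}"
      unfolding l1_norm_def
      by (intro closed_Collect_eq continuous_on_sum continuous_on_norm
          continuous_on_product_coordinates continuous_on_const)
    moreover have "S = P \<inter> {z. l1_norm d z = 1}"
    proof -
      have "z \<in> P" if "z \<in> S" for z
      proof -
        have "norm (z j) \<le> 1" if "j \<in> {1..d}" for j
          using member_le_sum[of j "{1..d}" "\<lambda>j. norm (z j)"] that \<open>z \<in> S\<close>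
          by (simp add: S_def l1_norm_def)
        then show ?thesis using \<open>z \<in> S\<close> by (auto simp: P_def S_def l1_carrier_def PiE_iff)
      qed
      moreover have "z \<in> l1_carrier d" if "z \<in> P" for z
        using that by (auto simp: P_def l1_carrier_def PiE_iff split: if_splits)
      ultimately show ?thesis unfolding S_def by blast
    qed
    ultimately show ?thesis by (simp add: compact_Int_closed)
  qed
  obtain A where A: "A > 0" and sphere: "\<And>z. z \<in> S \<Longrightarrow> 1 \<le> A * norm (f z)"
  proof (cases "S = {}")
    case True
    then show ?thesis using that[of 1] by simp
  next
    case False
    have "continuous_on S (\<lambda>z. norm (f z))"
      by (intro continuous_on_norm continuous_on_subset[OF f_cont]) simp
    from continuous_attains_inf[OF \<open>compact S\<close> False this]
    obtain z0 where z0: "z0 \<in> S" and min: "\<And>z. z \<in> S \<Longrightarrow> norm (f z0) \<le> norm (f z)" by auto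
    have "f z0 \<noteq> 0"
    proof
      assume "f z0 = 0"
      with inj[of z0] z0 have "z0 = (\<lambda>_. 0)" by (auto simp: S_def f_def)
      then show False using z0 by (simp add: S_def l1_norm_def)
    qed
    then show ?thesis
      using min by (intro that[of "inverse (norm (f z0))"]) (auto simp: field_simps)
  qed
  have "l1_norm d z \<le> A * norm (f z)" if z: "z \<in> l1_carrier d" for z
  proof (cases "l1_norm d z = 0")
    case True
    then show ?thesis using A by simp
  next
    case False
    define r where "r = l1_norm d z"
    have r: "r > 0" using False unfolding r_def l1_norm_def by (simp add: sum_nonneg order_less_le)
    let ?z = "\<lambda>j. of_real (inverse r) * z j :: 'k"
    have "?z \<in> S"
      using z r unfolding S_def l1_carrier_def l1_norm_def
      by (simp add: norm_mult norm_inverse sum_distrib_left[symmetric])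
         (simp add: r_def l1_norm_def)
    then have "1 \<le> A * norm (f ?z)" by (rule sphere)
    also have "f ?z = smul (of_real (inverse r)) (f z)"
      unfolding f_def scale_sum_right by simp
    also have "norm \<dots> = norm (f z) / r"
      using r unfolding norm_smul by (simp add: norm_inverse divide_inverse mult.commute)
    finally show ?thesis using r unfolding r_def[symmetric] by (simp add: field_simps)
  qed
  then show thesis using A that unfolding f_def by blast
qed

end

text \<open>
  The form in which the hypothesis on the spaces is used.  The isomorphism \<open>v\<close> onto \<open>\<ell>\<^sub>1\<^sup>d\<close> is divided by
  its norm, so that all of the distortion \<open>C\<close> sits in the vectors \<open>b l\<close>, the preimages of the unit
  vectors, and the coordinates \<open>w\<close> are contractive.  That the operator norms of \<open>v\<close> and of its inverse
  are suprema of bounded sets has to be proved before they give any estimate.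
\<close>

lemma script_L1_space_coordinates:
  fixes smul :: "'k::{real_normed_field,euclidean_space} \<Rightarrow> 'a::real_normed_vector \<Rightarrow> 'a"
  assumes "normed_space_over smul" and X: "script_L1_space smul X"
  obtains C where "C \<ge> 1"
    and "\<And>B. finite B \<Longrightarrow> B \<subseteq> X \<Longrightarrow>
      \<exists>F d (b :: nat \<Rightarrow> 'a) (w :: 'a \<Rightarrow> nat \<Rightarrow> 'k).
        module.subspace smul F \<and> B \<subseteq> F \<and> F \<subseteq> X \<and>
        (\<forall>l\<in>{1..d}. b l \<in> F \<and> norm (b l) \<le> C) \<and>
        (\<forall>x\<in>F. x = (\<Sum>l=1..d. smul (w x l) (b l)) \<and> (\<Sum>l=1..d. norm (w x l)) \<le> norm x) \<and>
        (\<forall>x\<in>F. \<forall>y\<in>F. \<forall>l. w (x + y) l = w x l + w y l) \<and>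
        (\<forall>c. \<forall>x\<in>F. \<forall>l. w (smul c x) l = c * w x l)"
proof -
  interpret normed_space_over smul by fact
  obtain C where "C \<ge> 1" and C: "\<And>E. fin_dim_subspace smul E \<Longrightarrow> E \<subseteq> X \<Longrightarrow>
        \<exists>F v d. fin_dim_subspace smul F \<and> E \<subseteq> F \<and> F \<subseteq> X \<and> linear_iso_l1 smul F d v \<and>
              op_norm F norm (l1_norm d) v *
                op_norm (l1_carrier d) (l1_norm d) norm (inv_into F v) \<le> C"
    using X unfolding script_L1_space_def Let_def by metis
  have subX: "subspace X" using X by (simp add: script_L1_space_def banach_subspace_def)
  show thesis
  proof (rule that[OF \<open>C \<ge> 1\<close>])
    fix B assume B: "finite B" "B \<subseteq> X"
    then have "fin_dim_subspace smul (span B)" "span B \<subseteq> X"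
      using subX by (auto simp: fin_dim_subspace_def span_minimal)
    from C[OF this] obtain F v d where F: "fin_dim_subspace smul F" "span B \<subseteq> F" "F \<subseteq> X"
      and iso: "linear_iso_l1 smul F d v"
      and le_C: "op_norm F norm (l1_norm d) v *
                op_norm (l1_carrier d) (l1_norm d) norm (inv_into F v) \<le> C" by blast
    have subF: "subspace F" using F(1) by (auto simp: fin_dim_subspace_def)
    define u where "u = inv_into F v"
    define e where "e l = (\<lambda>j. if j = l then 1 else 0 :: 'k)" for l :: nat
    define b where "b l = u (e l)" for l
    have bij: "bij_betw v F (l1_carrier d)"
      and v_add: "\<And>x y. x \<in> F \<Longrightarrow> y \<in> F \<Longrightarrow> v (x + y) = (\<lambda>j. v x j + v y j)"
      and v_smul: "\<And>c x. x \<in> F \<Longrightarrow> v (smul c x) = (\<lambda>j. c * v x j)"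
      using iso unfolding linear_iso_l1_def by blast+
    have u_F: "u z \<in> F" and v_u: "v (u z) = z" if "z \<in> l1_carrier d" for z
      using bij that unfolding u_def by (auto simp: bij_betw_def inv_into_into f_inv_into_f)
    have u_v: "u (v x) = x" and v_mem: "v x \<in> l1_carrier d" if "x \<in> F" for x
      using bij that unfolding u_def by (auto simp: bij_betw_def)
    have e: "e l \<in> l1_carrier d" "l1_norm d (e l) = 1" if "l \<in> {1..d}" for l
    proof -
      show "e l \<in> l1_carrier d" using that by (auto simp: e_def l1_carrier_def)
      have "l1_norm d (e l) = (\<Sum>j=1..d. if j = l then 1 else 0)"
        unfolding l1_norm_def e_def by (rule sum.cong) auto
      then show "l1_norm d (e l) = 1" using that by simp
    qed
    have b_F: "b l \<in> F" if "l \<in> {1..d}" for l unfolding b_def by (rule u_F[OF e(1)[OF that]])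
    have comb_F: "(\<Sum>l\<in>L. smul (z l) (b l)) \<in> F" if "L \<subseteq> {1..d}" for L and z :: "nat \<Rightarrow> 'k"
      using that by (intro subspace_sum[OF subF] subspace_scale[OF subF] b_F) auto
    have v_zero: "v 0 = (\<lambda>_. 0)" using v_smul[of 0 0] subspace_0[OF subF] by simp
    have v_comb: "v (\<Sum>l\<in>L. smul (z l) (b l)) = (\<lambda>j. \<Sum>l\<in>L. z l * e l j)"
      if "finite L" "L \<subseteq> {1..d}" for L and z :: "nat \<Rightarrow> 'k"
      using that
    proof (induction L)
      case empty
      then show ?case by (simp add: v_zero)
    next
      case (insert l L)
      then have "v (smul (z l) (b l) + (\<Sum>l\<in>L. smul (z l) (b l)))
          = (\<lambda>j. v (smul (z l) (b l)) j + v (\<Sum>l\<in>L. smul (z l) (b l)) j)"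
        by (intro v_add subspace_scale[OF subF] b_F comb_F) auto
      moreover have "v (smul (z l) (b l)) = (\<lambda>j. z l * e l j)"
        using insert by (subst v_smul) (auto simp: b_def v_u e intro: b_F[unfolded b_def])
      ultimately show ?case using insert by simp
    qed
    have expand: "u z = (\<Sum>l=1..d. smul (z l) (b l))" if z: "z \<in> l1_carrier d" for z
    proof -
      have "v (\<Sum>l=1..d. smul (z l) (b l)) = z"
      proof
        fix j
        have "(\<Sum>l=1..d. z l * e l j) = (\<Sum>l=1..d. if l = j then z l else 0)"
          by (rule sum.cong) (auto simp: e_def)
        then show "v (\<Sum>l=1..d. smul (z l) (b l)) j = z j"
          using z by (subst v_comb) (auto simp: l1_carrier_def)
      qed
      then show ?thesis using u_v[OF comb_F[of "{1..d}" z]] by simp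
    qed
    obtain A' where "A' > 0" and A': "\<And>z. z \<in> l1_carrier d \<Longrightarrow> l1_norm d z \<le> A' * norm (u z)"
    proof (rule l1_norm_le_norm[of d b])
      show "z = (\<lambda>_. 0)" if "z \<in> l1_carrier d" "(\<Sum>l=1..d. smul (z l) (b l)) = 0" for z
        using v_u[OF that(1)] that(2) expand[OF that(1)] v_zero by simp
    qed (use that expand in auto)
    define A where "A = op_norm F norm (l1_norm d) v"
    define R where "R = op_norm (l1_carrier d) (l1_norm d) norm u"
    have v_le: "l1_norm d (v x) \<le> A * norm x" if x: "x \<in> F" for x
    proof (cases "x = 0")
      case True
      then show ?thesis by (simp add: v_zero l1_norm_def)
    next
      case False
      let ?r = "of_real (inverse (norm x)) :: 'k"
      have bdd: "bdd_above ((\<lambda>x. l1_norm d (v x)) ` {x \<in> F. norm x \<le> 1})"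
      proof (rule bdd_aboveI2)
        fix y assume "y \<in> {x \<in> F. norm x \<le> 1}"
        then show "l1_norm d (v y) \<le> A' * 1"
          using A'[OF v_mem[of y]] \<open>A' > 0\<close> u_v[of y]
          by (auto intro: order_trans mult_left_mono)
      qed
      have "l1_norm d (v (smul ?r x)) \<le> A"
        unfolding A_def op_norm_def
        using x False subspace_scale[OF subF x, of ?r]
        by (intro cSUP_upper[OF _ bdd]) (simp add: norm_smul norm_inverse)
      also have "l1_norm d (v (smul ?r x)) = inverse (norm x) * l1_norm d (v x)"
        unfolding v_smul[OF x] l1_norm_def by (simp add: norm_mult norm_inverse sum_distrib_left)
      finally show ?thesis using False by (simp add: field_simps)
    qed
    have b_le: "norm (b l) \<le> R" if l: "l \<in> {1..d}" for l
    proof -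
      have bdd: "bdd_above ((\<lambda>z. norm (u z)) ` {z \<in> l1_carrier d. l1_norm d z \<le> 1})"
      proof (rule bdd_aboveI2)
        fix z :: "nat \<Rightarrow> 'k" assume z: "z \<in> {z \<in> l1_carrier d. l1_norm d z \<le> 1}"
        have "norm (z j) \<le> 1" if "j \<in> {1..d}" for j
          using member_le_sum[of j "{1..d}" "\<lambda>j. norm (z j)"] that z by (simp add: l1_norm_def)
        then have "(\<Sum>l=1..d. norm (z l) * norm (b l)) \<le> (\<Sum>l=1..d. 1 * norm (b l))"
          by (intro sum_mono mult_right_mono) auto
        with norm_smul_sum_le[of z b "{1..d}"]
        show "norm (u z) \<le> (\<Sum>l=1..d. 1 * norm (b l))"
          using z by (simp add: expand)
      qed
      show ?thesis unfolding b_def R_def op_norm_def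
        using e[OF l] by (intro cSUP_upper[OF _ bdd]) simp
    qed
    \<comment> \<open>For \<open>d = 0\<close> the norm of \<open>v\<close> is 0, and any positive scaling will do.\<close>
    define a where "a = (if d = 0 then 1 else A)"
    have a: "a > 0" and a_R: "d \<noteq> 0 \<Longrightarrow> a * R \<le> C"
    proof -
      show "a > 0"
      proof (cases "d = 0")
        case False
        then have "l1_norm d (v (b 1)) = 1" by (simp add: b_def v_u e)
        with v_le[OF b_F[of 1]] False have "1 \<le> A * norm (b 1)" by simp
        then have "0 < A * norm (b 1)" by linarith
        then have "A > 0" by (simp add: zero_less_mult_iff)
        then show ?thesis using False by (simp add: a_def)
      qed (simp add: a_def)
      show "a * R \<le> C" if "d \<noteq> 0" using that le_C by (simp add: a_def A_def R_def u_def)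
    qed
    define w where "w x l = of_real (inverse a) * v x l" for x l
    define b' where "b' l = smul (of_real a) (b l)" for l
    have 1: "b' l \<in> F \<and> norm (b' l) \<le> C" if l: "l \<in> {1..d}" for l
    proof
      show "b' l \<in> F" unfolding b'_def by (intro subspace_scale[OF subF] b_F l)
      have "norm (b' l) \<le> a * R" using a b_le[OF l] by (simp add: b'_def norm_smul)
      then show "norm (b' l) \<le> C" using a_R l by simp
    qed
    have 2: "x = (\<Sum>l=1..d. smul (w x l) (b' l)) \<and> (\<Sum>l=1..d. norm (w x l)) \<le> norm x" if x: "x \<in> F" for x
    proof
      have "x = (\<Sum>l=1..d. smul (v x l) (b l))" using expand[OF v_mem[OF x]] u_v[OF x] by simp
      also have "\<dots> = (\<Sum>l=1..d. smul (w x l) (b' l))"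
        using a by (intro sum.cong) (auto simp: w_def b'_def)
      finally show "x = (\<Sum>l=1..d. smul (w x l) (b' l))" .
      have "(\<Sum>l=1..d. norm (w x l)) = l1_norm d (v x) / a"
        using a by (simp add: w_def norm_mult norm_inverse l1_norm_def sum_distrib_left divide_inverse mult.commute)
      also have "\<dots> \<le> norm x"
      proof (cases "d = 0")
        case False
        then show ?thesis using v_le[OF x] a by (simp add: a_def pos_divide_le_eq mult.commute)
      qed (simp add: l1_norm_def)
      finally show "(\<Sum>l=1..d. norm (w x l)) \<le> norm x" .
    qed
    have 3: "w (x + y) l = w x l + w y l" if "x \<in> F" "y \<in> F" for x y l
      by (simp add: w_def v_add that distrib_left)
    have 4: "w (smul c x) l = c * w x l" if "x \<in> F" for c x l
      by (simp add: w_def v_smul that)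
    have "B \<subseteq> F" using F(2) span_superset by blast
    then show "\<exists>F d (b :: nat \<Rightarrow> 'a) (w :: 'a \<Rightarrow> nat \<Rightarrow> 'k).
        module.subspace smul F \<and> B \<subseteq> F \<and> F \<subseteq> X \<and>
        (\<forall>l\<in>{1..d}. b l \<in> F \<and> norm (b l) \<le> C) \<and>
        (\<forall>x\<in>F. x = (\<Sum>l=1..d. smul (w x l) (b l)) \<and> (\<Sum>l=1..d. norm (w x l)) \<le> norm x) \<and>
        (\<forall>x\<in>F. \<forall>y\<in>F. \<forall>l. w (x + y) l = w x l + w y l) \<and>
        (\<forall>c. \<forall>x\<in>F. \<forall>l. w (smul c x) l = c * w x l)"
      using subF F(3) 1 2 3 4 by blast
  qed
qed

section \<open>Bounded multilinear forms\<close>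

text \<open>
  Multilinearity is separated from the other clauses of \<open>bounded_multilinear\<close>, since forms are moved below
  between the whole product and smaller ones, which changes the domain of extensionality.
\<close>

definition multilinear_on ::
    "('k::{real_normed_field,euclidean_space} \<Rightarrow> 'a::real_normed_vector \<Rightarrow> 'a)
      \<Rightarrow> ('k \<Rightarrow> 'b::real_normed_vector \<Rightarrow> 'b) \<Rightarrow> nat \<Rightarrow> (nat \<Rightarrow> 'a set) \<Rightarrow> ((nat \<Rightarrow> 'a) \<Rightarrow> 'b) \<Rightarrow> bool" where
  "multilinear_on smulX smulY n X T \<longleftrightarrow>
     (\<forall>u\<in>(\<Pi>\<^sub>E i\<in>{1..n}. X i). \<forall>i\<in>{1..n}. \<forall>x\<in>X i. \<forall>y\<in>X i.
        T (u(i := x + y)) = T (u(i := x)) + T (u(i := y))) \<and>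
     (\<forall>u\<in>(\<Pi>\<^sub>E i\<in>{1..n}. X i). \<forall>i\<in>{1..n}. \<forall>c. \<forall>x\<in>X i.
        T (u(i := smulX c x)) = smulY c (T (u(i := x))))"

lemma multilinear_on_add:
  "multilinear_on smulX smulY n X T \<Longrightarrow> u \<in> (\<Pi>\<^sub>E i\<in>{1..n}. X i) \<Longrightarrow> i \<in> {1..n} \<Longrightarrow>
   x \<in> X i \<Longrightarrow> y \<in> X i \<Longrightarrow> T (u(i := x + y)) = T (u(i := x)) + T (u(i := y))"
  unfolding multilinear_on_def by blast

lemma multilinear_on_smul:
  "multilinear_on smulX smulY n X T \<Longrightarrow> u \<in> (\<Pi>\<^sub>E i\<in>{1..n}. X i) \<Longrightarrow> i \<in> {1..n} \<Longrightarrow>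
   x \<in> X i \<Longrightarrow> T (u(i := smulX c x)) = smulY c (T (u(i := x)))"
  unfolding multilinear_on_def by blast

lemma bounded_multilinear_iff:
  "T \<in> bounded_multilinear smulX smulY n X \<longleftrightarrow>
     T \<in> extensional (\<Pi>\<^sub>E i\<in>{1..n}. X i) \<and> multilinear_on smulX smulY n X T \<and>
     bounded (T ` unit_ball_prod n X)"
  unfolding bounded_multilinear_def multilinear_on_def by blast

lemma fun_upd_in_PiE:
  assumes "u \<in> Pi\<^sub>E I X" "i \<in> I" "x \<in> X i"
  shows "u(i := x) \<in> Pi\<^sub>E I X"
  using PiE_fun_upd[OF assms(3,1)] assms(2) by (simp add: insert_absorb)

lemma override_in_PiE:
  assumes "u \<in> Pi\<^sub>E I X" "A \<subseteq> I" "\<And>j. j \<in> A \<Longrightarrow> y j \<in> X j"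
  shows "(\<lambda>j. if j \<in> A then y j else u j) \<in> Pi\<^sub>E I X"
  using assms by (auto simp: PiE_iff extensional_def)

context normed_space_over
begin

lemma multilinear_on_zero:
  fixes \<phi> :: "(nat \<Rightarrow> 'a) \<Rightarrow> 'k"
  assumes "multilinear_on smul (*) n X \<phi>" "\<And>i. i \<in> {1..n} \<Longrightarrow> subspace (X i)"
    and "u \<in> (\<Pi>\<^sub>E i\<in>{1..n}. X i)" "i \<in> {1..n}"
  shows "\<phi> (u(i := 0)) = 0"
  using multilinear_on_smul[OF assms(1,3,4), of 0 0] subspace_0[OF assms(2)[OF assms(4)]] by simp

lemma multilinear_on_sum:
  fixes \<phi> :: "(nat \<Rightarrow> 'a) \<Rightarrow> 'k"
  assumes \<phi>: "multilinear_on smul (*) n X \<phi>" and X: "\<And>i. i \<in> {1..n} \<Longrightarrow> subspace (X i)"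
    and u: "u \<in> (\<Pi>\<^sub>E i\<in>{1..n}. X i)" and i: "i \<in> {1..n}"
    and L: "finite L" "\<And>l. l \<in> L \<Longrightarrow> b l \<in> X i"
  shows "\<phi> (u(i := \<Sum>l\<in>L. smul (c l) (b l))) = (\<Sum>l\<in>L. c l * \<phi> (u(i := b l)))"
  using L
proof (induction L)
  case empty
  show ?case unfolding sum.empty by (rule multilinear_on_zero[OF \<phi> X u i])
next
  case (insert l L)
  have "(\<Sum>l\<in>L. smul (c l) (b l)) \<in> X i" "smul (c l) (b l) \<in> X i" "b l \<in> X i"
    using insert by (auto intro!: subspace_sum[OF X[OF i]] subspace_scale[OF X[OF i]])
  then show ?case
    unfolding sum.insert[OF insert.hyps]
    by (simp only: multilinear_on_add[OF \<phi> u i] multilinear_on_smul[OF \<phi> u i] insert.IH[OF insert.prems] insertI2)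
qed

lemma multilinear_on_scale_all:
  fixes \<phi> :: "(nat \<Rightarrow> 'a) \<Rightarrow> 'k"
  assumes \<phi>: "multilinear_on smul (*) n X \<phi>" and X: "\<And>i. i \<in> {1..n} \<Longrightarrow> subspace (X i)"
    and u: "u \<in> (\<Pi>\<^sub>E i\<in>{1..n}. X i)" and A: "finite A" "A \<subseteq> {1..n}"
  shows "\<phi> (\<lambda>j. if j \<in> A then smul (c j) (u j) else u j) = (\<Prod>j\<in>A. c j) * \<phi> u"
  using A
proof (induction A)
  case empty
  show ?case by simp
next
  case (insert i A)
  let ?u = "\<lambda>j. if j \<in> A then smul (c j) (u j) else u j"
  have i: "i \<in> {1..n}" and ui: "u i \<in> X i" using insert u by auto
  have "?u \<in> (\<Pi>\<^sub>E i\<in>{1..n}. X i)"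
    using insert u by (intro override_in_PiE subspace_scale[OF X]) auto
  from multilinear_on_smul[OF \<phi> this i ui, of "c i"]
  have "\<phi> (?u(i := smul (c i) (u i))) = c i * \<phi> (?u(i := u i))" .
  also have "?u(i := u i) = ?u" using insert by auto
  also have "?u(i := smul (c i) (u i)) = (\<lambda>j. if j \<in> insert i A then smul (c j) (u j) else u j)"
    using insert by auto
  finally show ?case using insert by (simp add: mult.assoc)
qed

text \<open>
  Expansion along bases, one coordinate at a time.  The set \<open>A\<close> of coordinates that have
  already been expanded is kept general for the induction; the case of interest is \<open>A = {1..n}\<close>.
\<close>

lemma multilinear_on_expand:
  fixes \<phi> :: "(nat \<Rightarrow> 'a) \<Rightarrow> 'k" and D :: "nat \<Rightarrow> 'd set"
  assumes \<phi>: "multilinear_on smul (*) n X \<phi>" and X: "\<And>i. i \<in> {1..n} \<Longrightarrow> subspace (X i)"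
    and u: "u \<in> (\<Pi>\<^sub>E i\<in>{1..n}. X i)" and A: "finite A" "A \<subseteq> {1..n}"
    and D: "\<And>j. j \<in> {1..n} \<Longrightarrow> finite (D j)"
    and b: "\<And>j l. j \<in> {1..n} \<Longrightarrow> l \<in> D j \<Longrightarrow> b j l \<in> X j"
    and u_eq: "\<And>j. j \<in> {1..n} \<Longrightarrow> u j = (\<Sum>l\<in>D j. smul (c j l) (b j l))"
  shows "\<phi> u = (\<Sum>\<alpha>\<in>Pi\<^sub>E A D. (\<Prod>j\<in>A. c j (\<alpha> j)) * \<phi> (\<lambda>j. if j \<in> A then b j (\<alpha> j) else u j))"
  using A
proof (induction A)
  case empty
  show ?case by simp
next
  case (insert i A)
  have i: "i \<in> {1..n}" using insert by auto
  let ?u = "\<lambda>\<alpha> j. if j \<in> A then b j (\<alpha> j) else u j"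
  have split: "\<phi> (?u \<alpha>) = (\<Sum>l\<in>D i. c i l * \<phi> ((?u (\<alpha>(i := l)))(i := b i l)))"
    if \<alpha>: "\<alpha> \<in> Pi\<^sub>E A D" for \<alpha>
  proof -
    have u': "?u \<alpha> \<in> (\<Pi>\<^sub>E i\<in>{1..n}. X i)"
      using \<alpha> insert by (intro override_in_PiE[OF u]) (auto intro!: b)
    have main: "\<phi> ((?u \<alpha>)(i := \<Sum>l\<in>D i. smul (c i l) (b i l)))
        = (\<Sum>l\<in>D i. c i l * \<phi> ((?u \<alpha>)(i := b i l)))"
      by (rule multilinear_on_sum[OF \<phi> X u' i D[OF i]]) (use b i in auto)
    have restore: "(?u \<alpha>)(i := \<Sum>l\<in>D i. smul (c i l) (b i l)) = ?u \<alpha>"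
      using u_eq[OF i] insert by (auto simp: fun_eq_iff)
    have shift: "(?u \<alpha>)(i := b i l) = (?u (\<alpha>(i := l)))(i := b i l)" for l
      using insert by (auto simp: fun_eq_iff)
    show ?thesis using main unfolding restore shift .
  qed
  have "\<phi> u = (\<Sum>\<alpha>\<in>Pi\<^sub>E A D. (\<Prod>j\<in>A. c j (\<alpha> j)) * \<phi> (?u \<alpha>))"
    using insert by simp
  also have "\<dots> = (\<Sum>\<alpha>\<in>Pi\<^sub>E A D. \<Sum>l\<in>D i.
      (\<Prod>j\<in>A. c j (\<alpha> j)) * (c i l * \<phi> ((?u (\<alpha>(i := l)))(i := b i l))))"
    by (intro sum.cong refl) (simp only: split sum_distrib_left)
  also have "\<dots> = (\<Sum>(l, \<alpha>)\<in>D i \<times> Pi\<^sub>E A D.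
      (\<Prod>j\<in>A. c j (\<alpha> j)) * (c i l * \<phi> ((?u (\<alpha>(i := l)))(i := b i l))))"
    by (subst sum.swap) (simp add: sum.cartesian_product)
  also have "\<dots> = (\<Sum>(l, \<alpha>)\<in>D i \<times> Pi\<^sub>E A D.
      (\<Prod>j\<in>insert i A. c j ((\<alpha>(i := l)) j))
        * \<phi> (\<lambda>j. if j \<in> insert i A then b j ((\<alpha>(i := l)) j) else u j))"
  proof (intro sum.cong refl, clarify)
    fix l \<alpha>
    have "(\<Prod>j\<in>insert i A. c j ((\<alpha>(i := l)) j)) = c i l * (\<Prod>j\<in>A. c j (\<alpha> j))"
      using insert by (subst prod.insert) (auto intro!: arg_cong2[of _ _ _ _ "(*)"] prod.cong)
    moreover have "(?u (\<alpha>(i := l)))(i := b i l)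
        = (\<lambda>j. if j \<in> insert i A then b j ((\<alpha>(i := l)) j) else u j)"
      using insert by (auto simp: fun_eq_iff)
    ultimately show "(\<Prod>j\<in>A. c j (\<alpha> j)) * (c i l * \<phi> ((?u (\<alpha>(i := l)))(i := b i l)))
       = (\<Prod>j\<in>insert i A. c j ((\<alpha>(i := l)) j))
        * \<phi> (\<lambda>j. if j \<in> insert i A then b j ((\<alpha>(i := l)) j) else u j)"
      by (simp only:) simp
  qed
  also have "\<dots> = (\<Sum>\<alpha>\<in>Pi\<^sub>E (insert i A) D. (\<Prod>j\<in>insert i A. c j (\<alpha> j))
      * \<phi> (\<lambda>j. if j \<in> insert i A then b j (\<alpha> j) else u j))"
    unfolding PiE_insert_eq
    by (subst sum.reindex[OF inj_combinator]) (use insert in \<open>auto simp: o_def case_prod_unfold\<close>)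
  finally show ?case .
qed

lemma form_ball_bound:
  assumes \<phi>: "\<phi> \<in> form_ball smul n X" and X: "\<And>i. i \<in> {1..n} \<Longrightarrow> subspace (X i)"
    and u: "u \<in> (\<Pi>\<^sub>E i\<in>{1..n}. X i)"
  shows "norm (\<phi> u) \<le> (\<Prod>j=1..n. norm (u j))"
proof -
  have ml: "multilinear_on smul (*) n X \<phi>" and bdd: "bounded (\<phi> ` unit_ball_prod n X)"
    and le1: "(SUP u\<in>unit_ball_prod n X. norm (\<phi> u)) \<le> 1"
    using \<phi> by (auto simp: form_ball_def bounded_multilinear_iff)
  show ?thesis
  proof (cases "\<exists>i\<in>{1..n}. u i = 0")
    case True
    then obtain i where i: "i \<in> {1..n}" "u i = 0" by blast
    then have "\<phi> u = 0" using multilinear_on_zero[OF ml X u i(1)] by (metis fun_upd_triv)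
    then show ?thesis by (simp add: prod_nonneg)
  next
    case False
    define c where "c j = (of_real (inverse (norm (u j))) :: 'k)" for j
    let ?u = "\<lambda>j. if j \<in> {1..n} then smul (c j) (u j) else u j"
    have "?u \<in> unit_ball_prod n X"
      using u False unfolding unit_ball_prod_def
      by (auto simp: PiE_iff extensional_def c_def norm_smul norm_inverse intro!: subspace_scale[OF X])
    moreover have "bdd_above ((\<lambda>u. norm (\<phi> u)) ` unit_ball_prod n X)"
      using bdd by (auto simp: bounded_iff intro: bdd_aboveI2)
    ultimately have "norm (\<phi> ?u) \<le> 1" using le1 cSUP_upper order_trans by fast
    moreover have "\<phi> ?u = (\<Prod>j=1..n. c j) * \<phi> u"
      by (rule multilinear_on_scale_all[OF ml X u]) auto
    ultimately have "(\<Prod>j=1..n. norm (c j)) * norm (\<phi> u) \<le> 1" by (simp add: norm_mult prod_norm)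
    moreover have "(\<Prod>j=1..n. norm (c j)) = inverse (\<Prod>j=1..n. norm (u j))"
      unfolding prod_inversef[symmetric] by (simp add: c_def norm_inverse o_def)
    moreover have "(\<Prod>j=1..n. norm (u j)) > 0" using False by (intro prod_pos) auto
    ultimately show ?thesis by (simp add: field_simps)
  qed
qed

lemma restrict_in_form_ball:
  assumes ml: "multilinear_on smul (*) n X \<phi>" and X: "\<And>i. i \<in> {1..n} \<Longrightarrow> subspace (X i)"
    and bound: "\<And>u. u \<in> (\<Pi>\<^sub>E i\<in>{1..n}. X i) \<Longrightarrow> norm (\<phi> u) \<le> (\<Prod>j=1..n. norm (u j))"
  shows "restrict \<phi> (\<Pi>\<^sub>E i\<in>{1..n}. X i) \<in> form_ball smul n X"
proof -
  let ?U = "\<Pi>\<^sub>E i\<in>{1..n}. X i"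
  have le1: "norm (restrict \<phi> ?U u) \<le> 1" if "u \<in> unit_ball_prod n X" for u
  proof -
    have u: "u \<in> ?U" and "\<And>j. j \<in> {1..n} \<Longrightarrow> norm (u j) \<le> 1"
      using that by (auto simp: unit_ball_prod_def PiE_iff)
    then have "(\<Prod>j=1..n. norm (u j)) \<le> 1" by (intro prod_le_1) auto
    then show ?thesis using bound[OF u] u by simp
  qed
  have "(\<lambda>j\<in>{1..n}. 0) \<in> unit_ball_prod n X"
    using X by (auto simp: unit_ball_prod_def subspace_0)
  then have "(SUP u\<in>unit_ball_prod n X. norm (restrict \<phi> ?U u)) \<le> 1"
    using le1 by (intro cSUP_least) auto
  moreover have "bounded (restrict \<phi> ?U ` unit_ball_prod n X)"
    using le1 unfolding bounded_iff by blast
  moreover have "multilinear_on smul (*) n X (restrict \<phi> ?U)"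
    using ml X unfolding multilinear_on_def
    by (auto simp: fun_upd_in_PiE subspace_add subspace_scale)
  ultimately show ?thesis by (simp add: form_ball_def bounded_multilinear_iff)
qed

end

section \<open>Localization to finite-dimensional subspaces\<close>

context normed_space_over
begin

text \<open>
  The supremum over the ball of forms on \<open>X\<^sub>1 \<times> \<dots> \<times> X\<^sub>n\<close> can only grow when the spaces shrink, since a
  form on subspaces need not extend with the same norm.  But in the limit over finite-dimensional subspaces
  nothing is gained: otherwise there are offending forms on arbitrarily large subspaces, and
  extended by 0 they have a cluster point in a product of balls (Tychonoff), which is a form on the
  whole product with the same offending value.  Compactness is used through the finite intersection
  property of the sets \<open>K B\<close> of functions that are multilinear as far as the points of \<open>B\<close> can tell.
\<close>

lemma form_ball_localizes:
  fixes u v :: "'i \<Rightarrow> nat \<Rightarrow> 'a"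
  assumes X: "\<And>j. j \<in> {1..n} \<Longrightarrow> subspace (X j)" and I: "finite I"
    and u: "\<And>i. i \<in> I \<Longrightarrow> u i \<in> (\<Pi>\<^sub>E j\<in>{1..n}. X j)"
    and v: "\<And>i. i \<in> I \<Longrightarrow> v i \<in> (\<Pi>\<^sub>E j\<in>{1..n}. X j)"
    and less: "\<And>\<phi>. \<phi> \<in> form_ball smul n X \<Longrightarrow> (\<Sum>i\<in>I. norm (\<phi> (u i) - \<phi> (v i))) < W"
  obtains B where "\<And>j. j \<in> {1..n} \<Longrightarrow> finite (B j) \<and> B j \<subseteq> X j"
    and "\<And>F \<phi>. \<lbrakk>\<And>j. j \<in> {1..n} \<Longrightarrow> subspace (F j) \<and> B j \<subseteq> F j \<and> F j \<subseteq> X j;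
           multilinear_on smul (*) n F \<phi>;
           \<And>x. x \<in> (\<Pi>\<^sub>E j\<in>{1..n}. F j) \<Longrightarrow> norm (\<phi> x) \<le> (\<Prod>j=1..n. norm (x j))\<rbrakk>
         \<Longrightarrow> (\<Sum>i\<in>I. norm (\<phi> (u i) - \<phi> (v i))) < W \<and>
             (\<forall>i\<in>I. u i \<in> (\<Pi>\<^sub>E j\<in>{1..n}. F j) \<and> v i \<in> (\<Pi>\<^sub>E j\<in>{1..n}. F j))"
proof -
  let ?U = "\<Pi>\<^sub>E j\<in>{1..n}. X j"
  \<comment> \<open>The coordinates of the given points, so that forms on larger subspaces can be evaluated there.\<close>
  define V where "V j = (\<lambda>i. u i j) ` I \<union> (\<lambda>i. v i j) ` I" for j
  have V: "finite (V j)" "V j \<subseteq> X j" if "j \<in> {1..n}" for j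
    using I u v that by (auto simp: V_def PiE_iff)
  define adm where "adm = {B. \<forall>j\<in>{1..n}. finite (B j) \<and> V j \<subseteq> B j \<and> B j \<subseteq> X j}"
  have points: "u i \<in> (\<Pi>\<^sub>E j\<in>{1..n}. F j)" "v i \<in> (\<Pi>\<^sub>E j\<in>{1..n}. F j)"
    if "i \<in> I" "\<And>j. j \<in> {1..n} \<Longrightarrow> V j \<subseteq> F j" for i F
  proof -
    have "u i j \<in> F j" "v i j \<in> F j" if "j \<in> {1..n}" for j
      using \<open>i \<in> I\<close> \<open>\<And>j. j \<in> {1..n} \<Longrightarrow> V j \<subseteq> F j\<close>[OF that] by (auto simp: V_def)
    then show "u i \<in> (\<Pi>\<^sub>E j\<in>{1..n}. F j)" "v i \<in> (\<Pi>\<^sub>E j\<in>{1..n}. F j)"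
      using u[OF that(1)] v[OF that(1)] by (auto simp: PiE_iff)
  qed
  define good where "good B \<longleftrightarrow> (\<forall>F \<phi>. (\<forall>j\<in>{1..n}. subspace (F j) \<and> B j \<subseteq> F j \<and> F j \<subseteq> X j) \<longrightarrow>
           multilinear_on smul (*) n F \<phi> \<longrightarrow>
           (\<forall>x\<in>(\<Pi>\<^sub>E j\<in>{1..n}. F j). norm (\<phi> x) \<le> (\<Prod>j=1..n. norm (x j))) \<longrightarrow>
           (\<Sum>i\<in>I. norm (\<phi> (u i) - \<phi> (v i))) < W)" for B
  define Z where "Z = PiE UNIV (\<lambda>x. cball (0::'k) (if x \<in> ?U then \<Prod>j=1..n. norm (x j) else 0))"
  define K where "K B = {\<phi> :: (nat \<Rightarrow> 'a) \<Rightarrow> 'k.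
      (\<forall>x\<in>(\<Pi>\<^sub>E j\<in>{1..n}. B j). \<forall>j\<in>{1..n}. \<forall>y\<in>B j. \<forall>z\<in>B j.
          \<phi> (x(j := y + z)) = \<phi> (x(j := y)) + \<phi> (x(j := z))) \<and>
      (\<forall>x\<in>(\<Pi>\<^sub>E j\<in>{1..n}. B j). \<forall>j\<in>{1..n}. \<forall>c. \<forall>y\<in>B j.
          \<phi> (x(j := smul c y)) = c * \<phi> (x(j := y))) \<and>
      W \<le> (\<Sum>i\<in>I. norm (\<phi> (u i) - \<phi> (v i)))}" for B
  have "\<exists>B\<in>adm. good B"
  proof (rule ccontr)
    assume "\<not> ?thesis"
    then have bad: "\<not> good B" if "B \<in> adm" for B using that by blast
    have "compact Z" unfolding Z_def by (rule compact_PiE_UNIV) simp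
    moreover have "closed (K B)" for B
      unfolding K_def Ball_def
      by (intro closed_Collect_conj closed_Collect_imp open_Collect_const closed_Collect_all
          closed_Collect_eq closed_Collect_le continuous_intros continuous_on_product_coordinates)
    moreover have "Z \<inter> \<Inter> (K ` \<B>) \<noteq> {}" if "finite \<B>" "\<B> \<subseteq> adm" for \<B>
    proof -
      define B where "B j = V j \<union> (\<Union>B\<in>\<B>. B j)" for j
      have "B \<in> adm" using that V unfolding adm_def B_def by (auto simp: subset_iff)
      from bad[OF this] obtain F \<phi>
        where F': "\<forall>j\<in>{1..n}. subspace (F j) \<and> B j \<subseteq> F j \<and> F j \<subseteq> X j"
        and ml: "multilinear_on smul (*) n F \<phi>"
        and bd: "\<forall>x\<in>(\<Pi>\<^sub>E j\<in>{1..n}. F j). norm (\<phi> x) \<le> (\<Prod>j=1..n. norm (x j))"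
        and ge: "\<not> (\<Sum>i\<in>I. norm (\<phi> (u i) - \<phi> (v i))) < W"
        unfolding good_def not_all not_imp by (elim exE conjE) (rule that)
      have F: "subspace (F j)" "B j \<subseteq> F j" "F j \<subseteq> X j" if "j \<in> {1..n}" for j
        using F' that by blast+
      define \<psi> where "\<psi> x = (if x \<in> (\<Pi>\<^sub>E j\<in>{1..n}. F j) then \<phi> x else 0)" for x
      have F_U: "x \<in> ?U" if "x \<in> (\<Pi>\<^sub>E j\<in>{1..n}. F j)" for x
        using that PiE_mono[of "{1..n}" F X] F(3) by blast
      have "\<psi> \<in> Z"
        unfolding Z_def \<psi>_def using bd F_U by (auto simp: PiE_iff prod_nonneg)
      moreover have "\<psi> \<in> K B'" if "B' \<in> \<B>" for B'
      proof -
        have sub: "B' j \<subseteq> F j" if "j \<in> {1..n}" for j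
          using F(2)[OF that] \<open>B' \<in> \<B>\<close> by (auto simp: B_def)
        have in_F: "x(j := y) \<in> (\<Pi>\<^sub>E j\<in>{1..n}. F j)"
          if "x \<in> (\<Pi>\<^sub>E j\<in>{1..n}. B' j)" "j \<in> {1..n}" "y \<in> F j" for x j y
        proof (rule fun_upd_in_PiE[where X=F, OF _ that(2,3)])
          show "x \<in> (\<Pi>\<^sub>E j\<in>{1..n}. F j)" using that(1) PiE_mono[of "{1..n}" B' F] sub by blast
        qed
        have x_F: "x \<in> (\<Pi>\<^sub>E j\<in>{1..n}. F j)" if "x \<in> (\<Pi>\<^sub>E j\<in>{1..n}. B' j)" for x
          using that PiE_mono[of "{1..n}" B' F] sub by blast
        have "\<psi> (x(j := y + z)) = \<psi> (x(j := y)) + \<psi> (x(j := z))"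
          if "x \<in> (\<Pi>\<^sub>E j\<in>{1..n}. B' j)" "j \<in> {1..n}" "y \<in> B' j" "z \<in> B' j" for x j y z
        proof -
          have yz: "y \<in> F j" "z \<in> F j" using that(3,4) sub[OF that(2)] by blast+
          have "y + z \<in> F j" by (rule subspace_add[OF F(1)[OF that(2)] yz])
          note yz = yz this
          show ?thesis
            unfolding \<psi>_def using in_F[OF that(1,2)] yz
              multilinear_on_add[OF ml x_F[OF that(1)] that(2) yz(1,2)] by simp
        qed
        moreover have "\<psi> (x(j := smul c y)) = c * \<psi> (x(j := y))"
          if "x \<in> (\<Pi>\<^sub>E j\<in>{1..n}. B' j)" "j \<in> {1..n}" "y \<in> B' j" for x j y c
        proof -
          have y: "y \<in> F j" using that(3) sub[OF that(2)] by blast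
          have "smul c y \<in> F j" by (rule subspace_scale[OF F(1)[OF that(2)] y])
          note y = y this
          show ?thesis
            unfolding \<psi>_def using in_F[OF that(1,2)] y
              multilinear_on_smul[OF ml x_F[OF that(1)] that(2) y(1)] by simp
        qed
        moreover have "(\<Sum>i\<in>I. norm (\<psi> (u i) - \<psi> (v i))) = (\<Sum>i\<in>I. norm (\<phi> (u i) - \<phi> (v i)))"
        proof (rule sum.cong[OF refl])
          fix i assume "i \<in> I"
          from points[OF this, of F] F(2)
          show "norm (\<psi> (u i) - \<psi> (v i)) = norm (\<phi> (u i) - \<phi> (v i))"
            by (simp add: \<psi>_def B_def)
        qed
        ultimately show ?thesis unfolding K_def using ge by auto
      qed
      ultimately show ?thesis by blast
    qed
    ultimately have "Z \<inter> \<Inter> (K ` adm) \<noteq> {}" by (rule compact_imp_fip_image)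
    then obtain \<psi> where "\<psi> \<in> Z" and \<psi>: "\<And>B. B \<in> adm \<Longrightarrow> \<psi> \<in> K B" by blast
    have "multilinear_on smul (*) n X \<psi>"
      unfolding multilinear_on_def
    proof (intro conjI ballI allI)
      fix x j y z c
      assume x: "x \<in> ?U" and j: "j \<in> {1..n}" and y: "y \<in> X j"
      { fix z assume z: "z \<in> X j"
        define B where "B i = V i \<union> {x i} \<union> (if i = j then {y, z} else {})" for i
        have "B \<in> adm"
          using x y z V by (auto simp: adm_def B_def PiE_iff)
        moreover have "x \<in> (\<Pi>\<^sub>E j\<in>{1..n}. B j)" using x by (auto simp: B_def PiE_iff)
        moreover have "y \<in> B j" "z \<in> B j" by (auto simp: B_def)
        ultimately have "\<psi> (x(j := y + z)) = \<psi> (x(j := y)) + \<psi> (x(j := z)) \<and>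
            \<psi> (x(j := smul c y)) = c * \<psi> (x(j := y))"
          using \<psi>[of B] j unfolding K_def by blast }
      note both = this
      show "\<psi> (x(j := smul c y)) = c * \<psi> (x(j := y))" using both[OF y] by blast
      show "\<psi> (x(j := y + z)) = \<psi> (x(j := y)) + \<psi> (x(j := z))" if "z \<in> X j"
        using both[OF that] by blast
    qed
    moreover have "norm (\<psi> x) \<le> (\<Prod>j=1..n. norm (x j))" if "x \<in> ?U" for x
      using \<open>\<psi> \<in> Z\<close> that by (auto simp: Z_def PiE_iff dest!: spec[of _ x])
    ultimately have "restrict \<psi> ?U \<in> form_ball smul n X"
      by (intro restrict_in_form_ball X)
    from less[OF this] have "(\<Sum>i\<in>I. norm (\<psi> (u i) - \<psi> (v i))) < W"
      using u v by (simp cong: sum.cong)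
    moreover have "V \<in> adm" using V by (simp add: adm_def)
    ultimately show False using \<psi>[of V] unfolding K_def by simp
  qed
  then obtain B where "B \<in> adm" "good B" by blast
  show thesis
  proof (rule that[of B])
    show "finite (B j) \<and> B j \<subseteq> X j" if "j \<in> {1..n}" for j
      using \<open>B \<in> adm\<close> that by (auto simp: adm_def)
    fix F \<phi>
    assume F: "\<And>j. j \<in> {1..n} \<Longrightarrow> subspace (F j) \<and> B j \<subseteq> F j \<and> F j \<subseteq> X j"
      and ml: "multilinear_on smul (*) n F \<phi>"
      and bd: "\<And>x. x \<in> (\<Pi>\<^sub>E j\<in>{1..n}. F j) \<Longrightarrow> norm (\<phi> x) \<le> (\<Prod>j=1..n. norm (x j))"
    have "\<forall>j\<in>{1..n}. subspace (F j) \<and> B j \<subseteq> F j \<and> F j \<subseteq> X j" using F by blast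
    from \<open>good B\<close>[unfolded good_def, THEN spec, THEN spec, THEN mp, OF this, THEN mp, OF ml]
    have "(\<Sum>i\<in>I. norm (\<phi> (u i) - \<phi> (v i))) < W" using bd by blast
    moreover have sub: "V j \<subseteq> F j" if "j \<in> {1..n}" for j
      using F[OF that] \<open>B \<in> adm\<close> that unfolding adm_def by blast
    ultimately show "(\<Sum>i\<in>I. norm (\<phi> (u i) - \<phi> (v i))) < W \<and>
             (\<forall>i\<in>I. u i \<in> (\<Pi>\<^sub>E j\<in>{1..n}. F j) \<and> v i \<in> (\<Pi>\<^sub>E j\<in>{1..n}. F j))"
      by (intro conjI ballI points sub)
  qed
qed

section \<open>Weak summability of differences of elementary tensors\<close>

text \<open>
  On a product of spaces \<open>\<ell>\<^sub>1\<^sup>d\<close> the forms of norm at most 1 correspond to the arrays of scalars of modulus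
  at most 1.  Transported by contractive coordinates \<open>w\<close>, such an array still gives a form of norm at
  most 1.
\<close>

lemma array_form:
  fixes t :: "(nat \<Rightarrow> nat) \<Rightarrow> 'k" and w :: "nat \<Rightarrow> 'a \<Rightarrow> nat \<Rightarrow> 'k"
    and d :: "nat \<Rightarrow> nat" and n :: nat
  defines "J \<equiv> \<Pi>\<^sub>E j\<in>{1..n}. {1..d j}"
  defines "\<phi> \<equiv> \<lambda>x. \<Sum>\<alpha>\<in>J. (\<Prod>j=1..n. w j (x j) (\<alpha> j)) * t \<alpha>"
  assumes t: "\<And>\<alpha>. \<alpha> \<in> J \<Longrightarrow> norm (t \<alpha>) \<le> 1"
    and w_add: "\<And>j x y l. j \<in> {1..n} \<Longrightarrow> x \<in> F j \<Longrightarrow> y \<in> F j \<Longrightarrow> w j (x + y) l = w j x l + w j y l"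
    and w_smul: "\<And>j c x l. j \<in> {1..n} \<Longrightarrow> x \<in> F j \<Longrightarrow> w j (smul c x) l = c * w j x l"
    and w_norm: "\<And>j x. j \<in> {1..n} \<Longrightarrow> x \<in> F j \<Longrightarrow> (\<Sum>l=1..d j. norm (w j x l)) \<le> norm x"
  shows "multilinear_on smul (*) n F \<phi>"
    and "\<And>x. x \<in> (\<Pi>\<^sub>E j\<in>{1..n}. F j) \<Longrightarrow> norm (\<phi> x) \<le> (\<Prod>j=1..n. norm (x j))"
proof -
  have factor: "(\<Prod>j=1..n. w j ((x(i := y)) j) (\<alpha> j))
      = w i y (\<alpha> i) * (\<Prod>j\<in>{1..n} - {i}. w j (x j) (\<alpha> j))" if "i \<in> {1..n}" for x i y \<alpha>
    using that by (subst prod.remove[of _ i]) (auto intro!: arg_cong2[of _ _ _ _ "(*)"] prod.cong)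
  have coordinate: "\<phi> (x(i := y)) = (\<Sum>\<alpha>\<in>J. w i y (\<alpha> i) * ((\<Prod>j\<in>{1..n} - {i}. w j (x j) (\<alpha> j)) * t \<alpha>))"
    if "i \<in> {1..n}" for x i y
    unfolding \<phi>_def by (simp only: factor[OF that] mult.assoc)
  show "multilinear_on smul (*) n F \<phi>"
    unfolding multilinear_on_def
  proof (intro conjI ballI allI)
    fix x i y z c assume i: "i \<in> {1..n}" and y: "y \<in> F i"
    show "\<phi> (x(i := y + z)) = \<phi> (x(i := y)) + \<phi> (x(i := z))" if "z \<in> F i"
      by (simp only: coordinate[OF i] w_add[OF i y that] distrib_right sum.distrib)
    show "\<phi> (x(i := smul c y)) = c * \<phi> (x(i := y))"
      by (simp only: coordinate[OF i] w_smul[OF i y] sum_distrib_left mult.assoc)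
  qed
  fix x assume x: "x \<in> (\<Pi>\<^sub>E j\<in>{1..n}. F j)"
  have "norm (\<phi> x) \<le> (\<Sum>\<alpha>\<in>J. (\<Prod>j=1..n. norm (w j (x j) (\<alpha> j))))"
    unfolding \<phi>_def
  proof (rule sum_norm_le)
    fix \<alpha> assume "\<alpha> \<in> J"
    then show "norm ((\<Prod>j=1..n. w j (x j) (\<alpha> j)) * t \<alpha>) \<le> (\<Prod>j=1..n. norm (w j (x j) (\<alpha> j)))"
      unfolding norm_mult prod_norm[symmetric] by (intro mult_right_le_one_le t prod_nonneg) auto
  qed
  also have "\<dots> = (\<Prod>j=1..n. \<Sum>l=1..d j. norm (w j (x j) l))"
    unfolding J_def by (rule prod_sum_PiE[symmetric]) auto
  also have "\<dots> \<le> (\<Prod>j=1..n. norm (x j))"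
    using x by (intro prod_mono conjI w_norm sum_nonneg) auto
  finally show "norm (\<phi> x) \<le> (\<Prod>j=1..n. norm (x j))" .
qed

text \<open>
  If the differences \<open>\<delta>\<^sub>i = u\<^sub>i - v\<^sub>i\<close>, seen as functionals on forms, have weak \<open>\<ell>\<^sub>1\<close> norm below \<open>W\<close>, then
  \<open>\<delta>\<^sub>i / \<surd>h\<^sub>i\<close> is bounded in weak \<open>\<ell>\<^sub>2\<close> norm for weights with \<open>\<Sum>h\<^sub>i\<close> of order \<open>W\<close>: the projective tensor
  product of the \<open>X\<^sub>j\<close> behaves like an \<open>L\<^sub>1\<close> space.  After localization to subspaces \<open>F\<^sub>j\<close>
  isomorphic to \<open>\<ell>\<^sub>1\<^sup>d\<close>, evaluating forms at \<open>\<delta>\<^sub>i\<close> is the matrix \<open>a\<close> acting on arrays.  Arrays in the unit ball are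
  forms in the unit ball, which gives the hypothesis of \<open>change_of_density\<close>; conversely a form in the unit ball has
  values at the basis vectors bounded by the product \<open>D\<close> of the distortions, which transfers the
  conclusion back.
\<close>

theorem weak_l1_imp_weighted_weak_l2:
  fixes X :: "nat \<Rightarrow> 'a set"
  assumes X: "\<And>j. j \<in> {1..n} \<Longrightarrow> script_L1_space smul (X j)"
  obtains D where "D > 0"
    and "\<And>(I :: 'i set) u v W \<eta>. \<lbrakk>finite I;
        \<And>i. i \<in> I \<Longrightarrow> u i \<in> (\<Pi>\<^sub>E j\<in>{1..n}. X j); \<And>i. i \<in> I \<Longrightarrow> v i \<in> (\<Pi>\<^sub>E j\<in>{1..n}. X j);
        \<And>\<phi>. \<phi> \<in> form_ball smul n X \<Longrightarrow> (\<Sum>i\<in>I. norm (\<phi> (u i) - \<phi> (v i))) < W; \<eta> > 0\<rbrakk>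
      \<Longrightarrow> \<exists>h. (\<forall>i. h i > 0) \<and> (\<Sum>i\<in>I. h i) \<le> 36 * W + \<eta> \<and>
            (\<forall>\<phi>\<in>form_ball smul n X.
               (\<Sum>i\<in>I. (norm (\<phi> (u i) - \<phi> (v i)))\<^sup>2 / h i) \<le> D\<^sup>2 * (36 * W + \<eta>))"
proof -
  define coords where "coords j C B F d b w \<longleftrightarrow> subspace F \<and> B \<subseteq> F \<and> F \<subseteq> X j \<and>
        (\<forall>l\<in>{1..d}. b l \<in> F \<and> norm (b l) \<le> C) \<and>
        (\<forall>x\<in>F. x = (\<Sum>l=1..d. smul (w x l) (b l)) \<and> (\<Sum>l=1..d. norm (w x l)) \<le> norm x) \<and>
        (\<forall>x\<in>F. \<forall>y\<in>F. \<forall>l. w (x + y) l = w x l + w y l) \<and>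
        (\<forall>c. \<forall>x\<in>F. \<forall>l. w (smul c x) l = c * w x l)"
    for j C B F and d :: nat and b :: "nat \<Rightarrow> 'a" and w :: "'a \<Rightarrow> nat \<Rightarrow> 'k"
  have subX: "subspace (X j)" if "j \<in> {1..n}" for j
    using X[OF that] by (simp add: script_L1_space_def banach_subspace_def)
  have "\<exists>C\<ge>1. \<forall>B. finite B \<and> B \<subseteq> X j \<longrightarrow> (\<exists>F d b w. coords j C B F d b w)" if "j \<in> {1..n}" for j
  proof (rule script_L1_space_coordinates[OF normed_space_over_axioms X[OF that]])
    fix C :: real
    assume C1: "C \<ge> 1"
      and C: "\<And>B. finite B \<Longrightarrow> B \<subseteq> X j \<Longrightarrow> \<exists>F (d :: nat) (b :: nat \<Rightarrow> 'a) (w :: 'a \<Rightarrow> nat \<Rightarrow> 'k).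
        subspace F \<and> B \<subseteq> F \<and> F \<subseteq> X j \<and>
        (\<forall>l\<in>{1..d}. b l \<in> F \<and> norm (b l) \<le> C) \<and>
        (\<forall>x\<in>F. x = (\<Sum>l=1..d. smul (w x l) (b l)) \<and> (\<Sum>l=1..d. norm (w x l)) \<le> norm x) \<and>
        (\<forall>x\<in>F. \<forall>y\<in>F. \<forall>l. w (x + y) l = w x l + w y l) \<and>
        (\<forall>c. \<forall>x\<in>F. \<forall>l. w (smul c x) l = c * w x l)"
    show ?thesis
      by (rule exI[of _ C], intro conjI C1 allI impI, unfold coords_def, rule C) auto
  qed
  then have "\<exists>C. \<forall>j\<in>{1..n}. C j \<ge> 1 \<and>
      (\<forall>B. finite B \<and> B \<subseteq> X j \<longrightarrow> (\<exists>F d b w. coords j (C j) B F d b w))"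
    by (intro bchoice) blast
  then obtain C where C0: "\<forall>j\<in>{1..n}. C j \<ge> 1 \<and>
      (\<forall>B. finite B \<and> B \<subseteq> X j \<longrightarrow> (\<exists>F d b w. coords j (C j) B F d b w))" ..
  have C1: "C j \<ge> 1" if "j \<in> {1..n}" for j using C0[THEN bspec, OF that] ..
  have C: "\<exists>F d b w. coords j (C j) B F d b w" if "j \<in> {1..n}" "finite B" "B \<subseteq> X j" for j B
    using C0[THEN bspec, OF that(1), THEN conjunct2, THEN spec, THEN mp, OF conjI, OF that(2,3)] .
  define D where "D = (\<Prod>j=1..n. C j)"
  have D: "D > 0" unfolding D_def using C1 by (intro prod_pos) (force intro: less_le_trans[OF zero_less_one])
  show thesis
  proof (rule that[OF D])
    fix I :: "'i set" and u v :: "'i \<Rightarrow> nat \<Rightarrow> 'a" and W \<eta> :: real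
    assume I: "finite I" and u: "\<And>i. i \<in> I \<Longrightarrow> u i \<in> (\<Pi>\<^sub>E j\<in>{1..n}. X j)"
      and v: "\<And>i. i \<in> I \<Longrightarrow> v i \<in> (\<Pi>\<^sub>E j\<in>{1..n}. X j)"
      and less: "\<And>\<phi>. \<phi> \<in> form_ball smul n X \<Longrightarrow> (\<Sum>i\<in>I. norm (\<phi> (u i) - \<phi> (v i))) < W"
      and \<eta>: "\<eta> > 0"
    obtain B where B: "\<And>j. j \<in> {1..n} \<Longrightarrow> finite (B j) \<and> B j \<subseteq> X j"
      and local: "\<And>F \<phi>. \<lbrakk>\<And>j. j \<in> {1..n} \<Longrightarrow> subspace (F j) \<and> B j \<subseteq> F j \<and> F j \<subseteq> X j;
           multilinear_on smul (*) n F \<phi>;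
           \<And>x. x \<in> (\<Pi>\<^sub>E j\<in>{1..n}. F j) \<Longrightarrow> norm (\<phi> x) \<le> (\<Prod>j=1..n. norm (x j))\<rbrakk>
         \<Longrightarrow> (\<Sum>i\<in>I. norm (\<phi> (u i) - \<phi> (v i))) < W \<and>
             (\<forall>i\<in>I. u i \<in> (\<Pi>\<^sub>E j\<in>{1..n}. F j) \<and> v i \<in> (\<Pi>\<^sub>E j\<in>{1..n}. F j))"
      by (rule form_ball_localizes[OF subX I u v less]) blast+
    have "\<forall>j\<in>{1..n}. \<exists>F d b w. coords j (C j) (B j) F d b w"
      by (intro ballI C conjunct1[OF B] conjunct2[OF B])
    then obtain F d b w where "\<And>j. j \<in> {1..n} \<Longrightarrow> coords j (C j) (B j) (F j) (d j) (b j) (w j)"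
      by metis
    note co = this[unfolded coords_def]
    have F: "subspace (F j) \<and> B j \<subseteq> F j \<and> F j \<subseteq> X j" if "j \<in> {1..n}" for j
      using co[OF that] by blast
    have b: "b j l \<in> F j" "norm (b j l) \<le> C j" if "j \<in> {1..n}" "l \<in> {1..d j}" for j l
      using co[OF that(1)] that(2) by blast+
    have expand: "x = (\<Sum>l=1..d j. smul (w j x l) (b j l))" if "j \<in> {1..n}" "x \<in> F j" for j x
      using co[OF that(1)] that(2) by blast
    have w_norm: "(\<Sum>l=1..d j. norm (w j x l)) \<le> norm x" if "j \<in> {1..n}" "x \<in> F j" for j x
      using co[OF that(1)] that(2) by blast
    have w_add: "w j (x + y) l = w j x l + w j y l" if "j \<in> {1..n}" "x \<in> F j" "y \<in> F j" for j x y l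
      using co[OF that(1)] that(2,3) by blast
    have w_smul: "w j (smul c x) l = c * w j x l" if "j \<in> {1..n}" "x \<in> F j" for j c x l
      using co[OF that(1)] that(2) by blast
    define J where "J = (\<Pi>\<^sub>E j\<in>{1..n}. {1..d j})"
    define \<pi> where "\<pi> x \<alpha> = (\<Prod>j=1..n. w j (x j) (\<alpha> j))" for x \<alpha>
    define a where "a i \<alpha> = \<pi> (u i) \<alpha> - \<pi> (v i) \<alpha>" for i \<alpha>
    have functional: "functional J a i t = (\<Sum>\<alpha>\<in>J. \<pi> (u i) \<alpha> * t \<alpha>) - (\<Sum>\<alpha>\<in>J. \<pi> (v i) \<alpha> * t \<alpha>)" for i t
      by (simp add: functional_def a_def left_diff_distrib sum_subtractf)
    have array: "(\<Sum>i\<in>I. norm (functional J a i t)) < W \<and>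
        (\<forall>i\<in>I. u i \<in> (\<Pi>\<^sub>E j\<in>{1..n}. F j) \<and> v i \<in> (\<Pi>\<^sub>E j\<in>{1..n}. F j))"
      if t: "\<And>\<alpha>. \<alpha> \<in> J \<Longrightarrow> norm (t \<alpha>) \<le> 1" for t
    proof -
      define \<psi> where "\<psi> x = (\<Sum>\<alpha>\<in>J. \<pi> x \<alpha> * t \<alpha>)" for x
      have \<psi>: "\<psi> = (\<lambda>x. \<Sum>\<alpha>\<in>(\<Pi>\<^sub>E j\<in>{1..n}. {1..d j}). (\<Prod>j=1..n. w j (x j) (\<alpha> j)) * t \<alpha>)"
        unfolding \<psi>_def \<pi>_def J_def ..
      have ml: "multilinear_on smul (*) n F \<psi>"
        unfolding \<psi> by (rule array_form(1)[OF t[unfolded J_def] w_add w_smul w_norm])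
      have bd: "norm (\<psi> x) \<le> (\<Prod>j=1..n. norm (x j))" if "x \<in> (\<Pi>\<^sub>E j\<in>{1..n}. F j)" for x
        unfolding \<psi> by (rule array_form(2)[OF t[unfolded J_def] w_add w_smul w_norm that])
      show ?thesis
        unfolding functional \<psi>_def[symmetric] by (rule local[OF F ml bd])
    qed
    have in_F: "u i \<in> (\<Pi>\<^sub>E j\<in>{1..n}. F j)" "v i \<in> (\<Pi>\<^sub>E j\<in>{1..n}. F j)" if "i \<in> I" for i
      using array[of "\<lambda>_. 0"] that by auto
    obtain h where h: "\<And>i. h i > 0" and h_sum: "(\<Sum>i\<in>I. h i) \<le> 36 * W + \<eta>"
      and h_sq: "\<And>t. (\<And>\<alpha>. \<alpha> \<in> J \<Longrightarrow> norm (t \<alpha>) \<le> 1) \<Longrightarrow>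
           (\<Sum>i\<in>I. (norm (functional J a i t))\<^sup>2 / h i) \<le> 36 * W + \<eta>"
      by (rule change_of_density[OF _ \<eta>, where I=I and J=J and a=a and W=W]) (use array in \<open>blast intro: less_imp_le\<close>)+
    have "(\<Sum>i\<in>I. (norm (\<phi> (u i) - \<phi> (v i)))\<^sup>2 / h i) \<le> D\<^sup>2 * (36 * W + \<eta>)"
      if \<phi>: "\<phi> \<in> form_ball smul n X" for \<phi>
    proof -
      have ml: "multilinear_on smul (*) n X \<phi>"
        using \<phi> by (simp add: form_ball_def bounded_multilinear_iff)
      define s where "s \<alpha> = \<phi> (\<lambda>j\<in>{1..n}. b j (\<alpha> j))" for \<alpha>
      have s: "norm (s \<alpha>) \<le> D" if "\<alpha> \<in> J" for \<alpha>
      proof -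
        have \<alpha>: "\<alpha> j \<in> {1..d j}" if "j \<in> {1..n}" for j using \<open>\<alpha> \<in> J\<close> that by (auto simp: J_def)
        have "(\<lambda>j\<in>{1..n}. b j (\<alpha> j)) \<in> (\<Pi>\<^sub>E j\<in>{1..n}. X j)"
          using b(1)[OF _ \<alpha>] F by (intro restrict_PiE_iff[THEN iffD2]) blast
        from form_ball_bound[OF \<phi> subX this]
        have "norm (s \<alpha>) \<le> (\<Prod>j=1..n. norm (b j (\<alpha> j)))" by (simp add: s_def)
        also have "\<dots> \<le> D"
          unfolding D_def by (intro prod_mono conjI norm_ge_zero b(2) \<alpha>)
        finally show ?thesis .
      qed
      have \<phi>_eq: "\<phi> x = (\<Sum>\<alpha>\<in>J. \<pi> x \<alpha> * s \<alpha>)" if x: "x \<in> (\<Pi>\<^sub>E j\<in>{1..n}. F j)" for x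
      proof -
        have x': "x \<in> (\<Pi>\<^sub>E j\<in>{1..n}. X j)" using x PiE_mono[of "{1..n}" F X] F by blast
        have main: "\<phi> x = (\<Sum>\<alpha>\<in>Pi\<^sub>E {1..n} (\<lambda>j. {1..d j}). (\<Prod>j\<in>{1..n}. w j (x j) (\<alpha> j))
            * \<phi> (\<lambda>j. if j \<in> {1..n} then b j (\<alpha> j) else x j))"
        proof (rule multilinear_on_expand[OF ml subX x'])
          show "x j = (\<Sum>l=1..d j. smul (w j (x j) l) (b j l))" if "j \<in> {1..n}" for j
            by (rule expand[OF that PiE_mem[OF x that]])
        qed (use b(1) F in \<open>blast+\<close>)
        have base: "(\<lambda>j. if j \<in> {1..n} then b j (\<alpha> j) else x j) = (\<lambda>j\<in>{1..n}. b j (\<alpha> j))" for \<alpha>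
          using x by (auto simp: fun_eq_iff restrict_def PiE_iff extensional_def)
        show ?thesis using main unfolding base \<pi>_def J_def s_def .
      qed
      have diff: "\<phi> (u i) - \<phi> (v i) = functional J a i s" if "i \<in> I" for i
        unfolding functional \<phi>_eq[OF in_F(1)[OF that]] \<phi>_eq[OF in_F(2)[OF that]] ..
      have "(\<Sum>i\<in>I. (norm (functional J a i (\<lambda>\<alpha>. of_real (1 / D) * s \<alpha>)))\<^sup>2 / h i) \<le> 36 * W + \<eta>"
        using s D by (intro h_sq) (simp add: norm_mult norm_divide)
      then have "(\<Sum>i\<in>I. 1 / D\<^sup>2 * ((norm (functional J a i s))\<^sup>2 / h i)) \<le> 36 * W + \<eta>"
        unfolding functional_scale norm_mult norm_of_real power_mult_distrib by (simp add: power_divide)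
      then have "1 / D\<^sup>2 * (\<Sum>i\<in>I. (norm (functional J a i s))\<^sup>2 / h i) \<le> 36 * W + \<eta>"
        by (simp only: sum_distrib_left)
      then have "(\<Sum>i\<in>I. (norm (functional J a i s))\<^sup>2 / h i) \<le> D\<^sup>2 * (36 * W + \<eta>)"
        using D by (simp add: pos_divide_le_eq mult.commute)
      moreover have "(\<Sum>i\<in>I. (norm (\<phi> (u i) - \<phi> (v i)))\<^sup>2 / h i)
          = (\<Sum>i\<in>I. (norm (functional J a i s))\<^sup>2 / h i)"
        by (intro sum.cong refl) (simp only: diff)
      ultimately show ?thesis by simp
    qed
    then show "\<exists>h. (\<forall>i. h i > 0) \<and> (\<Sum>i\<in>I. h i) \<le> 36 * W + \<eta> \<and>
            (\<forall>\<phi>\<in>form_ball smul n X.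
               (\<Sum>i\<in>I. (norm (\<phi> (u i) - \<phi> (v i)))\<^sup>2 / h i) \<le> D\<^sup>2 * (36 * W + \<eta>))"
      using h h_sum by blast
  qed
qed

end

section \<open>Comparison of the two classes of operators\<close>

lemma normed_space_over_mult:
  "normed_space_over ((*) :: 'k::{real_normed_field,euclidean_space} \<Rightarrow> 'k \<Rightarrow> 'k)"
proof
  show "norm (c * x) = norm c * norm x" for c x :: 'k by (rule norm_mult)
  show "of_real r * x = r *\<^sub>R x" for r and x :: 'k by (simp add: scaleR_conv_of_real)
qed

text \<open>
  The device behind both inclusions: a multiple of a difference of two elementary tensors is again
  such a difference, as the scalar can be moved into the first factor.  Hence summing inequalities may be
  tested on weighted differences, although the operators are not linear.
\<close>

lemma multilinear_on_scale_first:
  fixes smulX :: "'k::{real_normed_field,euclidean_space} \<Rightarrow> 'a::real_normed_vector \<Rightarrow> 'a"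
  assumes Y: "normed_space_over smulY" and T: "multilinear_on smulX smulY n X T" and "n \<ge> 1"
    and x: "x \<in> (\<Pi>\<^sub>E j\<in>{1..n}. X j)" and y: "y \<in> (\<Pi>\<^sub>E j\<in>{1..n}. X j)"
  shows "norm (T (x(1 := smulX (of_real r) (x 1))) - T (y(1 := smulX (of_real r) (y 1))))
           = \<bar>r\<bar> * norm (T x - T y)"
proof -
  interpret Y: normed_space_over smulY by fact
  have 1: "1 \<in> {1..n}" using \<open>n \<ge> 1\<close> by simp
  have scale: "T (z(1 := smulX (of_real r) (z 1))) = smulY (of_real r) (T z)"
    if z: "z \<in> (\<Pi>\<^sub>E j\<in>{1..n}. X j)" for z
    using multilinear_on_smul[OF T z 1 PiE_mem[OF z 1], of "of_real r"] by simp
  show ?thesis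
    unfolding scale[OF x] scale[OF y] Y.scale_right_diff_distrib[symmetric] Y.norm_smul by simp
qed

context normed_space_over
begin

lemma form_ball_nonempty:
  assumes "\<And>j. j \<in> {1..n} \<Longrightarrow> subspace (X j)"
  shows "form_ball smul n X \<noteq> {}"
proof -
  have "restrict (\<lambda>_. 0) (\<Pi>\<^sub>E j\<in>{1..n}. X j) \<in> form_ball smul n X"
    using assms by (intro restrict_in_form_ball) (auto simp: multilinear_on_def prod_nonneg)
  then show ?thesis by blast
qed

text \<open>The suprema in the definition of \<open>Pi_Lip\<close> are over bounded sets, so they dominate each term.\<close>

lemma form_ball_sum_bdd_above:
  assumes X: "\<And>j. j \<in> {1..n} \<Longrightarrow> subspace (X j)" and "p > 0"
    and u: "\<And>i. i \<in> I \<Longrightarrow> u i \<in> (\<Pi>\<^sub>E j\<in>{1..n}. X j)"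
    and v: "\<And>i. i \<in> I \<Longrightarrow> v i \<in> (\<Pi>\<^sub>E j\<in>{1..n}. X j)"
  shows "bdd_above ((\<lambda>\<phi>. (\<Sum>i\<in>I. norm (\<phi> (u i) - \<phi> (v i)) powr p) powr (1 / p))
                     ` form_ball smul n X)"
proof (rule bdd_aboveI2)
  fix \<phi> assume \<phi>: "\<phi> \<in> form_ball smul n X"
  have "norm (\<phi> (u i) - \<phi> (v i)) \<le> (\<Prod>j=1..n. norm (u i j)) + (\<Prod>j=1..n. norm (v i j))"
    if "i \<in> I" for i
    using form_ball_bound[OF \<phi> X u[OF that]] form_ball_bound[OF \<phi> X v[OF that]]
      norm_triangle_ineq4[of "\<phi> (u i)" "\<phi> (v i)"] by linarith
  then show "(\<Sum>i\<in>I. norm (\<phi> (u i) - \<phi> (v i)) powr p) powr (1 / p)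
      \<le> (\<Sum>i\<in>I. ((\<Prod>j=1..n. norm (u i j)) + (\<Prod>j=1..n. norm (v i j))) powr p) powr (1 / p)"
    using \<open>p > 0\<close> by (intro powr_mono2 sum_mono sum_nonneg) auto
qed

end

text \<open>
  The general inclusion of 1-summing in 2-summing maps: test the 1-summing inequality on
  the differences weighted by \<open>\<tau>\<^sub>i = \<parallel>T u\<^sub>i - T v\<^sub>i\<parallel>\<close>, so that the left side becomes \<open>\<Sum>\<tau>\<^sub>i\<^sup>2\<close>, and apply the
  Cauchy-Schwarz inequality on the right.
\<close>

lemma Pi_Lip_1_subset_Pi_Lip_2:
  fixes smulX :: "'k::{real_normed_field,euclidean_space} \<Rightarrow> 'a::real_normed_vector \<Rightarrow> 'a"
    and smulY :: "'k \<Rightarrow> 'b::real_normed_vector \<Rightarrow> 'b"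
  assumes n: "n \<ge> 1" and smulX: "normed_space_over smulX" and smulY: "normed_space_over smulY"
    and X: "\<And>j. j \<in> {1..n} \<Longrightarrow> module.subspace smulX (X j)"
  shows "Pi_Lip 1 smulX smulY n X \<subseteq> Pi_Lip 2 smulX smulY n X"
proof
  interpret X: normed_space_over smulX by fact
  let ?U = "\<Pi>\<^sub>E j\<in>{1..n}. X j" and ?ball = "form_ball smulX n X"
  fix T assume T: "T \<in> Pi_Lip 1 smulX smulY n X"
  then obtain c where c: "c > 0" and summing: "\<And>(k :: nat) u v.
      (\<forall>i\<in>{1..k}. u i \<in> ?U \<and> v i \<in> ?U) \<Longrightarrow>
      (\<Sum>i=1..k. norm (T (u i) - T (v i)) powr 1) powr (1 / 1)
        \<le> c * (SUP \<phi>\<in>?ball. (\<Sum>i=1..k. norm (\<phi> (u i) - \<phi> (v i)) powr 1) powr (1 / 1))"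
    unfolding Pi_Lip_def by blast
  have ml: "multilinear_on smulX smulY n X T"
    using T by (simp add: Pi_Lip_def bounded_multilinear_iff)
  have "(\<Sum>i=1..k. norm (T (u i) - T (v i)) powr 2) powr (1 / 2)
      \<le> c * (SUP \<phi>\<in>?ball. (\<Sum>i=1..k. norm (\<phi> (u i) - \<phi> (v i)) powr 2) powr (1 / 2))"
    if uv: "\<forall>i\<in>{1..k}. u i \<in> ?U \<and> v i \<in> ?U" for k :: nat and u v
  proof -
    define \<tau> where "\<tau> i = norm (T (u i) - T (v i))" for i
    define A where "A = sqrt (\<Sum>i=1..k. (\<tau> i)\<^sup>2)"
    define f where "f \<phi> = sqrt (\<Sum>i=1..k. (norm (\<phi> (u i) - \<phi> (v i)))\<^sup>2)" for \<phi> :: "(nat \<Rightarrow> 'a) \<Rightarrow> 'k"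
    define scaled where "scaled x i = (x i)(1 := smulX (of_real (\<tau> i)) (x i 1))" for x :: "nat \<Rightarrow> nat \<Rightarrow> 'a" and i
    have powr_f: "(\<Sum>i=1..k. norm (\<phi> (u i) - \<phi> (v i)) powr 2) powr (1 / 2) = f \<phi>" for \<phi>
      by (simp add: f_def powr_half_sqrt sum_nonneg)
    have bdd: "bdd_above (f ` ?ball)"
      using X.form_ball_sum_bdd_above[of n X 2 "{1..k}" u v] X uv unfolding powr_f by auto
    define S where "S = (SUP \<phi>\<in>?ball. f \<phi>)"
    have f_le: "f \<phi> \<le> S" if "\<phi> \<in> ?ball" for \<phi>
      unfolding S_def by (rule cSUP_upper[OF that bdd])
    have f_nonneg: "f \<phi> \<ge> 0" for \<phi> by (simp add: f_def sum_nonneg)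
    obtain \<phi>0 where "\<phi>0 \<in> ?ball" using X.form_ball_nonempty[of n X] X by blast
    then have S: "S \<ge> 0" using f_le f_nonneg order_trans by blast
    have A: "A \<ge> 0" "A\<^sup>2 = (\<Sum>i=1..k. (\<tau> i)\<^sup>2)" by (simp_all add: A_def sum_nonneg)
    have 1: "1 \<in> {1..n}" using n by simp
    have scaled_U: "scaled x i \<in> ?U" if "x i \<in> ?U" for x i
      unfolding scaled_def
      by (intro fun_upd_in_PiE[OF that 1] X.subspace_scale X[OF 1] PiE_mem[OF that 1])
    have scaled_T: "norm (T (scaled u i) - T (scaled v i)) = (\<tau> i)\<^sup>2" if "i \<in> {1..k}" for i
      unfolding scaled_def using uv that
      by (subst multilinear_on_scale_first[OF smulY ml n]) (auto simp: \<tau>_def power2_eq_square)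
    have "A\<^sup>2 = (\<Sum>i=1..k. norm (T (scaled u i) - T (scaled v i)) powr 1) powr (1 / 1)"
      unfolding A(2) by (simp add: scaled_T sum_nonneg)
    also have "\<dots> \<le> c * (SUP \<phi>\<in>?ball.
        (\<Sum>i=1..k. norm (\<phi> (scaled u i) - \<phi> (scaled v i)) powr 1) powr (1 / 1))"
      by (rule summing, intro ballI conjI scaled_U) (use uv in \<open>blast+\<close>)
    also have "\<dots> \<le> c * (A * S)"
    proof (intro mult_left_mono cSUP_least)
      fix \<phi> assume \<phi>: "\<phi> \<in> ?ball"
      then have ml\<phi>: "multilinear_on smulX (*) n X \<phi>" by (simp add: form_ball_def bounded_multilinear_iff)
      have "(\<Sum>i=1..k. norm (\<phi> (scaled u i) - \<phi> (scaled v i)) powr 1) powr (1 / 1)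
          = (\<Sum>i=1..k. \<tau> i * norm (\<phi> (u i) - \<phi> (v i)))"
      proof -
        have "norm (\<phi> (scaled u i) - \<phi> (scaled v i)) = \<tau> i * norm (\<phi> (u i) - \<phi> (v i))" if "i \<in> {1..k}" for i
          unfolding scaled_def using uv that
          by (subst multilinear_on_scale_first[OF normed_space_over_mult ml\<phi> n]) (auto simp: \<tau>_def)
        then show ?thesis by (simp add: sum_nonneg \<tau>_def)
      qed
      also have "\<dots> \<le> A * f \<phi>"
      proof (rule power2_le_imp_le)
        show "(\<Sum>i=1..k. \<tau> i * norm (\<phi> (u i) - \<phi> (v i)))\<^sup>2 \<le> (A * f \<phi>)\<^sup>2"
          using Cauchy_Schwarz_ineq_sum[of \<tau> "\<lambda>i. norm (\<phi> (u i) - \<phi> (v i))" "{1..k}"]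
          by (simp add: A_def f_def power_mult_distrib sum_nonneg)
        show "A * f \<phi> \<ge> 0" using A f_nonneg by simp
      qed
      also have "\<dots> \<le> A * S" using A(1) f_le[OF \<phi>] by (rule mult_left_mono[rotated])
      finally show "(\<Sum>i=1..k. norm (\<phi> (scaled u i) - \<phi> (scaled v i)) powr 1) powr (1 / 1) \<le> A * S" .
    qed (use c \<open>\<phi>0 \<in> ?ball\<close> in auto)
    finally have "A * A \<le> A * (c * S)" by (simp add: power2_eq_square mult_ac)
    then have "A \<le> c * S"
      using A(1) c S by (cases "A = 0") auto
    moreover have "(\<Sum>i=1..k. norm (T (u i) - T (v i)) powr 2) powr (1 / 2) = A"
      by (simp add: A_def \<tau>_def powr_half_sqrt sum_nonneg)
    ultimately show ?thesis unfolding powr_f S_def by simp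
  qed
  then show "T \<in> Pi_Lip 2 smulX smulY n X"
    using T c unfolding Pi_Lip_def by blast
qed

text \<open>
  Test the 2-summing inequality on the differences weighted by \<open>1 / \<surd>h\<^sub>i\<close>, with the \<open>h\<close> of
  \<open>weak_l1_imp_weighted_weak_l2\<close>, and split
  \<open>\<Sum>\<tau>\<^sub>i \<le> (\<Sum>\<tau>\<^sub>i\<^sup>2 / h\<^sub>i)\<^sup>1\<^sup>/\<^sup>2 (\<Sum>h\<^sub>i)\<^sup>1\<^sup>/\<^sup>2\<close> by the Cauchy-Schwarz inequality.  Both factors are controlled by the weak \<open>\<ell>\<^sub>1\<close>
  norm of the differences.
\<close>

lemma Pi_Lip_2_subset_Pi_Lip_1:
  fixes smulX :: "'k::{real_normed_field,euclidean_space} \<Rightarrow> 'a::real_normed_vector \<Rightarrow> 'a"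
    and smulY :: "'k \<Rightarrow> 'b::real_normed_vector \<Rightarrow> 'b"
  assumes n: "n \<ge> 1" and smulX: "normed_space_over smulX" and smulY: "normed_space_over smulY"
    and L1: "\<And>j. j \<in> {1..n} \<Longrightarrow> script_L1_space smulX (X j)"
  shows "Pi_Lip 2 smulX smulY n X \<subseteq> Pi_Lip 1 smulX smulY n X"
proof
  interpret X: normed_space_over smulX by fact
  let ?U = "\<Pi>\<^sub>E j\<in>{1..n}. X j" and ?ball = "form_ball smulX n X"
  have X: "X.subspace (X j)" if "j \<in> {1..n}" for j
    using L1[OF that] by (simp add: script_L1_space_def banach_subspace_def)
  fix T assume T: "T \<in> Pi_Lip 2 smulX smulY n X"
  then obtain c where c: "c > 0" and summing: "\<And>(k :: nat) u v.
      (\<forall>i\<in>{1..k}. u i \<in> ?U \<and> v i \<in> ?U) \<Longrightarrow>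
      (\<Sum>i=1..k. norm (T (u i) - T (v i)) powr 2) powr (1 / 2)
        \<le> c * (SUP \<phi>\<in>?ball. (\<Sum>i=1..k. norm (\<phi> (u i) - \<phi> (v i)) powr 2) powr (1 / 2))"
    unfolding Pi_Lip_def by blast
  have ml: "multilinear_on smulX smulY n X T"
    using T by (simp add: Pi_Lip_def bounded_multilinear_iff)
  obtain D where D: "D > 0"
    and weights: "\<And>(I :: nat set) u v W \<eta>. \<lbrakk>finite I;
        \<And>i. i \<in> I \<Longrightarrow> u i \<in> ?U; \<And>i. i \<in> I \<Longrightarrow> v i \<in> ?U;
        \<And>\<phi>. \<phi> \<in> ?ball \<Longrightarrow> (\<Sum>i\<in>I. norm (\<phi> (u i) - \<phi> (v i))) < W; \<eta> > 0\<rbrakk>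
      \<Longrightarrow> \<exists>h. (\<forall>i. h i > 0) \<and> (\<Sum>i\<in>I. h i) \<le> 36 * W + \<eta> \<and>
            (\<forall>\<phi>\<in>?ball. (\<Sum>i\<in>I. (norm (\<phi> (u i) - \<phi> (v i)))\<^sup>2 / h i) \<le> D\<^sup>2 * (36 * W + \<eta>))"
    by (rule X.weak_l1_imp_weighted_weak_l2[OF L1]) blast+
  have "(\<Sum>i=1..k. norm (T (u i) - T (v i)) powr 1) powr (1 / 1)
      \<le> (c * D * 36) * (SUP \<phi>\<in>?ball. (\<Sum>i=1..k. norm (\<phi> (u i) - \<phi> (v i)) powr 1) powr (1 / 1))"
    if uv: "\<forall>i\<in>{1..k}. u i \<in> ?U \<and> v i \<in> ?U" for k :: nat and u v
  proof -
    define \<tau> where "\<tau> i = norm (T (u i) - T (v i))" for i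
    define g where "g \<phi> = (\<Sum>i=1..k. norm (\<phi> (u i) - \<phi> (v i)))" for \<phi> :: "(nat \<Rightarrow> 'a) \<Rightarrow> 'k"
    have powr_g: "(\<Sum>i=1..k. norm (\<phi> (u i) - \<phi> (v i)) powr 1) powr (1 / 1) = g \<phi>" for \<phi>
      by (simp add: g_def sum_nonneg)
    have bdd: "bdd_above (g ` ?ball)"
      using X.form_ball_sum_bdd_above[of n X 1 "{1..k}" u v] X uv unfolding powr_g by auto
    define S where "S = (SUP \<phi>\<in>?ball. g \<phi>)"
    have almost: "(\<Sum>i=1..k. \<tau> i) \<le> c * D * (36 * (S + \<eta>) + \<eta>)" if \<eta>: "\<eta> > 0" for \<eta>
    proof -
      define R where "R = 36 * (S + \<eta>) + \<eta>"
      have "(\<Sum>i=1..k. norm (\<phi> (u i) - \<phi> (v i))) < S + \<eta>" if "\<phi> \<in> ?ball" for \<phi>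
        using cSUP_upper[OF that bdd] \<eta> unfolding S_def g_def by simp
      moreover have "u i \<in> ?U" "v i \<in> ?U" if "i \<in> {1..k}" for i using uv that by blast+
      ultimately have "\<exists>h. (\<forall>i. h i > 0) \<and> (\<Sum>i=1..k. h i) \<le> R \<and>
          (\<forall>\<phi>\<in>?ball. (\<Sum>i=1..k. (norm (\<phi> (u i) - \<phi> (v i)))\<^sup>2 / h i) \<le> D\<^sup>2 * R)"
        unfolding R_def by (intro weights \<eta> finite_atLeastAtMost)
      then obtain h where h: "\<And>i. h i > 0" and h_sum: "(\<Sum>i=1..k. h i) \<le> R"
        and h_sq: "\<And>\<phi>. \<phi> \<in> ?ball \<Longrightarrow> (\<Sum>i=1..k. (norm (\<phi> (u i) - \<phi> (v i)))\<^sup>2 / h i) \<le> D\<^sup>2 * R"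
        by blast
      have R: "R \<ge> 0" using h_sum sum_nonneg[of "{1..k}" h] h by (meson less_imp_le order_trans)
      define scaled where "scaled x i = (x i)(1 := smulX (of_real (1 / sqrt (h i))) (x i 1))"
        for x :: "nat \<Rightarrow> nat \<Rightarrow> 'a" and i
      have 1: "1 \<in> {1..n}" using n by simp
      have scaled_U: "scaled x i \<in> ?U" if "x i \<in> ?U" for x i
        unfolding scaled_def
        by (intro fun_upd_in_PiE[OF that 1] X.subspace_scale X[OF 1] PiE_mem[OF that 1])
      have scaled: "(norm (G (scaled u i) - G (scaled v i)))\<^sup>2 = (norm (G (u i) - G (v i)))\<^sup>2 / h i"
        if "normed_space_over smul" "multilinear_on smulX smul n X G" "i \<in> {1..k}"
        for G :: "(nat \<Rightarrow> 'a) \<Rightarrow> 'c::real_normed_vector" and smul i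
        unfolding scaled_def using uv that(3) h[of i]
        by (subst multilinear_on_scale_first[OF that(1,2) n])
           (auto simp: power_mult_distrib power_divide)
      have "sqrt (\<Sum>i=1..k. (\<tau> i)\<^sup>2 / h i)
          = (\<Sum>i=1..k. norm (T (scaled u i) - T (scaled v i)) powr 2) powr (1 / 2)"
        using h by (simp add: powr_half_sqrt sum_nonneg less_imp_le scaled[OF smulY ml] \<tau>_def)
      also have "\<dots> \<le> c * (SUP \<phi>\<in>?ball.
          (\<Sum>i=1..k. norm (\<phi> (scaled u i) - \<phi> (scaled v i)) powr 2) powr (1 / 2))"
        by (rule summing, intro ballI conjI scaled_U) (use uv in \<open>blast+\<close>)
      also have "\<dots> \<le> c * (D * sqrt R)"
      proof (intro mult_left_mono cSUP_least)
        fix \<phi> assume \<phi>: "\<phi> \<in> ?ball"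
        then have ml\<phi>: "multilinear_on smulX (*) n X \<phi>"
          by (simp add: form_ball_def bounded_multilinear_iff)
        have "(\<Sum>i=1..k. norm (\<phi> (scaled u i) - \<phi> (scaled v i)) powr 2) powr (1 / 2)
            = sqrt (\<Sum>i=1..k. (norm (\<phi> (u i) - \<phi> (v i)))\<^sup>2 / h i)"
          using h by (simp add: powr_half_sqrt sum_nonneg less_imp_le scaled[OF normed_space_over_mult ml\<phi>])
        also have "\<dots> \<le> sqrt (D\<^sup>2 * R)" by (intro real_sqrt_le_mono h_sq \<phi>)
        also have "\<dots> = D * sqrt R" using D by (simp add: real_sqrt_mult)
        finally show "(\<Sum>i=1..k. norm (\<phi> (scaled u i) - \<phi> (scaled v i)) powr 2) powr (1 / 2)
            \<le> D * sqrt R" .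
      qed (use c X.form_ball_nonempty[of n X] X in auto)
      finally have weighted: "sqrt (\<Sum>i=1..k. (\<tau> i)\<^sup>2 / h i) \<le> c * (D * sqrt R)" .
      have "(\<Sum>i=1..k. \<tau> i) = (\<Sum>i=1..k. \<tau> i / sqrt (h i) * sqrt (h i))"
        using h by (intro sum.cong refl) (simp add: less_imp_neq[symmetric])
      also have "\<dots> \<le> sqrt (\<Sum>i=1..k. (\<tau> i)\<^sup>2 / h i) * sqrt (\<Sum>i=1..k. h i)"
      proof (rule power2_le_imp_le)
        have "(\<Sum>i=1..k. \<tau> i / sqrt (h i) * sqrt (h i))\<^sup>2
            \<le> (\<Sum>i=1..k. (\<tau> i / sqrt (h i))\<^sup>2) * (\<Sum>i=1..k. (sqrt (h i))\<^sup>2)"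
          by (rule Cauchy_Schwarz_ineq_sum)
        then show "(\<Sum>i=1..k. \<tau> i / sqrt (h i) * sqrt (h i))\<^sup>2
            \<le> (sqrt (\<Sum>i=1..k. (\<tau> i)\<^sup>2 / h i) * sqrt (\<Sum>i=1..k. h i))\<^sup>2"
          using h by (simp add: power_mult_distrib power_divide less_imp_le sum_nonneg)
      qed (use h in \<open>simp add: sum_nonneg less_imp_le\<close>)
      also have "\<dots> \<le> (c * (D * sqrt R)) * sqrt R"
        using weighted h_sum h R c D
        by (intro mult_mono) (auto simp: less_imp_le intro!: sum_nonneg)
      also have "\<dots> = c * D * R" using R by simp
      finally show ?thesis unfolding R_def .
    qed
    have "(\<Sum>i=1..k. \<tau> i) \<le> c * D * 36 * S"
    proof (rule field_le_epsilon)
      fix e :: real assume "e > 0"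
      \<comment> \<open>The error \<open>\<eta>\<close> enters 36 times through the weak norm and once through the weights.\<close>
      then have pos: "e / (37 * c * D) > 0" using c D by simp
      have "c * D * (36 * (S + e / (37 * c * D)) + e / (37 * c * D)) = c * D * 36 * S + e"
        using c D by (simp add: distrib_left)
      with almost[OF pos] show "(\<Sum>i=1..k. \<tau> i) \<le> c * D * 36 * S + e" by simp
    qed
    then show ?thesis unfolding powr_g S_def by (simp add: \<tau>_def sum_nonneg)
  qed
  moreover have "c * D * 36 > 0" using c D by simp
  ultimately show "T \<in> Pi_Lip 1 smulX smulY n X"
    using T unfolding Pi_Lip_def by blast
qed

theorem corollary3p10:
  fixes smulX :: "'k::{real_normed_field,euclidean_space} \<Rightarrow> 'a::real_normed_vector \<Rightarrow> 'a"
    and smulY :: "'k \<Rightarrow> 'b::banach \<Rightarrow> 'b"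
    and n :: nat
    and X :: "nat \<Rightarrow> 'a set"
  assumes "n \<ge> 1"
    and "normed_space_over smulX"
    and "normed_space_over smulY"
    and "\<And>i. i \<in> {1..n} \<Longrightarrow> script_L1_space smulX (X i)"
  shows "Pi_Lip 1 smulX smulY n X = Pi_Lip 2 smulX smulY n X"
proof
  show "Pi_Lip 1 smulX smulY n X \<subseteq> Pi_Lip 2 smulX smulY n X"
    using assms(4)
    by (intro Pi_Lip_1_subset_Pi_Lip_2[OF assms(1-3)])
       (simp add: script_L1_space_def banach_subspace_def)
  show "Pi_Lip 2 smulX smulY n X \<subseteq> Pi_Lip 1 smulX smulY n X"
    by (rule Pi_Lip_2_subset_Pi_Lip_1[OF assms])
qed

end
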